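(* (i) There exist absolute constants $C_1>0$, $C_2>0$ such that $$\big[e^{C_2 f/\|f\|_{BMO(\mathbb{D})}}\big]_{B_2}\le C_1$$ for any $f\in BMO(\mathbb{D})$ with $\|f\|_{BMO(\mathbb{D})}\neq0$. (ii) For any $f\in VMO(\mathbb{D})$, $$\lim_{\delta\to0+}\ \sup_{A(Q)<\delta}\Big(\frac1{A(Q)}\int_Q e^{f}\,dA\Big)\Big(\frac1{A(Q)}\int_Q e^{-f}\,dA\Big)=1,$$ where the supremum is taken over all Carleson squares $Q\subset\mathbb{D}$ with $A(Q)<\delta$. (iii) For any $w\in B_2$ and any $\lambda>2+\log[w]_{B_2}$, one has $$A(\{z\in Q: |\log w(z)-(\log w)_Q|>\lambda\})\le 2e^2[w]_{B_2}^2e^{-\lambda}A(Q)$$ for any Carleson square $Q\subset\mathbb{D}$. Moreover, if $w\in B_2$ is of bounded hyperbolic oscillation, then $\log w\in BMO(\mathbb{D})$.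
   Context: $\mathbb{D}$ is the open unit disc, $\partial\mathbb{D}$ the unit circle, $m$ is Lebesgue measure on $\partial\mathbb{D}$, $dA$ is normalized Lebesgue area measure on $\mathbb{D}$; $f_E$ denotes the mean of $f$ over a set $E$ with respect to $dA$. Carleson squares are the sets $Q_I=\{z\in\mathbb{D}\setminus\{0\}: z/|z|\in I,\ 1-|z|<m(I)\}$, for arcs $I\subset\partial\mathbb{D}$. A weight is a positive integrable function on $\mathbb{D}$; a weight $w$ is a $B_2$-weight ($w\in B_2$) if $$[w]_{B_2}^2=\sup_I\Big(\frac1{A(Q_I)}\int_{Q_I}w\,dA\Big)\Big(\frac1{A(Q_I)}\int_{Q_I}w^{-1}\,dA\Big)<\infty,$$ the supremum being over all arcs $I\subset\partial\mathbb{D}$; $[w]_{B_2}$ is the positive square root of this supremum. $BMO(\mathbb{D})$ is the space of integrable real-valued $f$ on $\mathbb{D}$ with $\|f\|_{BMO(\mathbb{D})}=\sup\frac1{A(D\cap\mathbb{D})}\int_{D\cap\mathbb{D}}|f-f_{D\cap\mathbb{D}}|\,dA<\infty$, the supremum being over all discs $D$ centered at points of $\mathbb{D}$. $VMO(\mathbb{D})$ is the closure in $BMO(\mathbb{D})$ of the polynomials (real-valued polynomials in the real coordinates $x,y$ of $z=x+iy$). The hyperbolic metric is $\beta(z,\zeta)=\frac12\log\frac{1+|\phi_z(\zeta)|}{1-|\phi_z(\zeta)|}$, where $\phi_z(\zeta)=\frac{z-\zeta}{1-\bar z\zeta}$, $z,\zeta\in\mathbb{D}$. A weight $w$ has bounded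 hyperbolic oscillation if there is a constant $C(w)>0$ with $|\log w(z)-\log w(\zeta)|\le C(w)(1+\beta(z,\zeta))$ for all $z,\zeta\in\mathbb{D}$. *)

theory Defs
  imports "HOL-Analysis.Analysis"
begin

abbreviation unit_disc :: "complex set" where
  "unit_disc \<equiv> ball 0 1"

definition area :: "complex measure" where
  "area = density (lebesgue_on unit_disc) (\<lambda>_. ennreal (1 / pi))"

text \<open>Arc length on the unit circle, of total mass \<open>2 * pi\<close>.  It is only evaluated on arcs,
  so Borel sets suffice.\<close>

definition circle_measure :: "complex measure" where
  "circle_measure = distr (restrict_space lborel {0..<2 * pi}) borel cis"

text \<open>Nondegenerate arcs, up to the full circle, with or without their end points.\<close>

definition arcs :: "complex set set" where
  "arcs = {cis ` J | J a b. a < b \<and> b \<le> a + 2 * pi \<and> {a<..<b} \<subseteq> J \<and> J \<subseteq> {a..b}}"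

definition carleson_square :: "complex set \<Rightarrow> complex set" where
  "carleson_square I = {z \<in> unit_disc - {0}.
     z / of_real (cmod z) \<in> I \<and> 1 - cmod z < measure circle_measure I}"

definition carleson_squares :: "complex set set" where
  "carleson_squares = carleson_square ` arcs"

definition mean :: "(complex \<Rightarrow> real) \<Rightarrow> complex set \<Rightarrow> real" where
  "mean f E = set_lebesgue_integral area E f / measure area E"

text \<open>The mean of a nonnegative function, with value \<open>\<infinity>\<close> if the function is not integrable over
  the set.\<close>

definition nn_mean :: "(complex \<Rightarrow> real) \<Rightarrow> complex set \<Rightarrow> ennreal" where
  "nn_mean g E = set_nn_integral area E (\<lambda>z. ennreal (g z)) / emeasure area E"

definition weight :: "(complex \<Rightarrow> real) \<Rightarrow> bool" where
  "weight w \<longleftrightarrow> integrable area w \<and> (\<forall>z\<in>unit_disc. 0 < w z)"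

definition B2_sup :: "(complex \<Rightarrow> real) \<Rightarrow> ennreal" where
  "B2_sup w = (SUP Q\<in>carleson_squares. nn_mean w Q * nn_mean (\<lambda>z. 1 / w z) Q)"

definition B2 :: "(complex \<Rightarrow> real) set" where
  "B2 = {w. weight w \<and> B2_sup w < \<infinity>}"

text \<open>This constant is meaningful for weights in \<open>B2\<close> only, since \<open>enn2real \<infinity> = 0\<close>.\<close>

definition B2_const :: "(complex \<Rightarrow> real) \<Rightarrow> real" where
  "B2_const w = sqrt (enn2real (B2_sup w))"

definition bmo_discs :: "complex set set" where
  "bmo_discs = {ball c r \<inter> unit_disc | c r. c \<in> unit_disc \<and> 0 < r}"

definition mean_osc :: "(complex \<Rightarrow> real) \<Rightarrow> complex set \<Rightarrow> real" where
  "mean_osc f E = mean (\<lambda>z. \<bar>f z - mean f E\<bar>) E"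

definition BMO :: "(complex \<Rightarrow> real) set" where
  "BMO = {f. integrable area f \<and> bdd_above (mean_osc f ` bmo_discs)}"

definition bmo_norm :: "(complex \<Rightarrow> real) \<Rightarrow> real" where
  "bmo_norm f = (SUP E\<in>bmo_discs. mean_osc f E)"

text \<open>On the real vector space \<^typ>\<open>complex\<close>, \<^const>\<open>real_polynomial_function\<close> describes exactly
  the real polynomials in \<^const>\<open>Re\<close> and \<^const>\<open>Im\<close>; these are bounded on the disc, hence in
  \<open>BMO\<close>.\<close>

definition VMO :: "(complex \<Rightarrow> real) set" where
  "VMO = {f \<in> BMO. \<forall>\<epsilon>>0. \<exists>p. real_polynomial_function p \<and> bmo_norm (\<lambda>z. f z - p z) < \<epsilon>}"

definition disc_involution :: "complex \<Rightarrow> complex \<Rightarrow> complex" where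
  "disc_involution z \<zeta> = (z - \<zeta>) / (1 - cnj z * \<zeta>)"

definition hyperbolic_dist :: "complex \<Rightarrow> complex \<Rightarrow> real" where
  "hyperbolic_dist z \<zeta> =
     1 / 2 * ln ((1 + cmod (disc_involution z \<zeta>)) / (1 - cmod (disc_involution z \<zeta>)))"

definition bounded_hyperbolic_oscillation :: "(complex \<Rightarrow> real) \<Rightarrow> bool" where
  "bounded_hyperbolic_oscillation w \<longleftrightarrow>
     (\<exists>C>0. \<forall>z\<in>unit_disc. \<forall>\<zeta>\<in>unit_disc.
        \<bar>ln (w z) - ln (w \<zeta>)\<bar> \<le> C * (1 + hyperbolic_dist z \<zeta>))"

end

theory Submission
  imports Defs
begin

text \<open>Write \<open>E(c, r)\<close> for \<open>ball c r \<inter> unit_disc\<close>; for \<open>r \<le> 2\<close> its area is comparable to \<open>r\<^sup>2\<close>.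
  If all mean oscillations of \<open>f\<close> are at most \<open>1\<close>, a stopping time argument with Vitali coverings
  in place of dyadic cubes gives the John--Nirenberg inequality: the part of \<open>E(c, r)\<close> where \<open>f\<close>
  differs by more than \<open>6400 k\<close> from its mean over \<open>E(c, 2 r)\<close> has area at most \<open>4\<^sup>-\<^sup>k r\<^sup>2\<close>.
  A Carleson square lies in such a set of comparable area, whence (i).  For (ii), a function in VMO
  is a polynomial, of small oscillation on small squares, plus a function of small norm, whose
  exponential mean is close to \<open>1\<close> by John--Nirenberg and convexity.  For (iii), Jensen's inequality
  bounds the means of \<open>e\<^bsup>\<plusminus>u\<^esup>\<close> over \<open>Q\<close>, where \<open>u = log w - (log w)\<^sub>Q\<close>, by \<open>[w]\<^sup>2\<close>, and Markov's
  inequality applies.  Finally, discs that are small compared to their distance to the circle are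
  hyperbolically bounded, and all others are contained in Carleson squares of comparable area.\<close>

section \<open>The area measure of the disc\<close>


text \<open>Dyadic stopping times rest on a nested family of sets, whereas truncated discs overlap
  and stick out of one another. Two devices make up for this. The level set is taken in E(c, r) but
  the mean over E(c, 2 r), so that a disc of radius at most r / 2 that meets \<open>ball c r\<close>
  stays where the oscillation is controlled. And a truncated disc keeps a fixed fraction of r^2 as
  its area, so that passing to an enlargement costs a bounded factor even at the circle. The
  constants come from there: the threshold 6400 forces stopping radii of at most r / 20, hence
  tenfold enlargements of at most r / 2; the decay 1 / 4 per level leaves room to integrate 2 to the
  power |f - a| / 6400, whence the exponent ln 2 / 6400 in (i); and 1280 = 5 * 256 compares the
  resulting bound 5 r^2 with the area of a Carleson square. The product of the means of exp f and
  exp (-f) does not change when a constant is added to f, so deviations may be measured from a mean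
  over E(c, 2 r) instead of one over the square.\<close>

lemma space_area [simp]: "space area = unit_disc"
  by (simp add: area_def)

lemma sets_area: "S \<in> sets area \<longleftrightarrow> S \<in> sets lebesgue \<and> S \<subseteq> unit_disc"
  by (auto simp: area_def sets_restrict_space_iff)

lemma emeasure_area:
  assumes "S \<in> sets lebesgue" "S \<subseteq> unit_disc"
  shows "emeasure area S = ennreal (1 / pi) * emeasure lebesgue S"
  using assms unfolding area_def
  by (subst emeasure_density_const) (auto simp: sets_restrict_space_iff emeasure_restrict_space)

lemma measure_area:
  assumes "S \<in> sets lebesgue" "S \<subseteq> unit_disc"
  shows "measure area S = measure lebesgue S / pi"
  by (simp add: emeasure_area[OF assms] measure_def enn2real_mult)

lemma measure_lebesgue_ball: "0 \<le> r \<Longrightarrow> measure lborel (ball (c::complex) r) = pi * r\<^sup>2"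
  by (simp add: content_ball DIM_complex unit_ball_vol_2)

lemma emeasure_area_space: "emeasure area unit_disc = 1"
  by (simp add: emeasure_area emeasure_ball DIM_complex unit_ball_vol_2 flip: ennreal_mult)

lemma finite_measure_area: "finite_measure area"
  by (rule finite_measureI) (simp add: emeasure_area_space)

interpretation area: finite_measure area
  by (rule finite_measure_area)

lemma nn_integral_area:
  assumes "g \<in> borel_measurable area"
  shows "(\<integral>\<^sup>+x. g x \<partial>area) = ennreal (1 / pi) * (\<integral>\<^sup>+x\<in>unit_disc. g x \<partial>lebesgue)"
proof -
  have [measurable]: "g \<in> borel_measurable (lebesgue_on unit_disc)"
    using assms by (simp add: area_def)
  show ?thesis
    unfolding area_def
    by (simp add: nn_integral_density nn_integral_cmult nn_integral_restrict_space)
qed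

lemma measurable_area_lebesgue:
  fixes g :: "complex \<Rightarrow> ennreal"
  assumes "g \<in> borel_measurable area"
  shows "(\<lambda>x. g x * indicator unit_disc x) \<in> borel_measurable lebesgue"
  using assms by (subst (asm) area_def) (simp add: borel_measurable_restrict_space_iff_ennreal)

lemma AE_area:
  assumes "AE x in lebesgue. P x"
  shows "AE x in area. P x"
  using assms unfolding area_def
  by (subst AE_density) (auto simp: AE_restrict_space_iff)

text \<open>Pulling the centre towards the origin by the factor \<open>1 - r / 2\<close> keeps a ball of half the
  radius inside the disc.\<close>

lemma area_disc_bounds:
  assumes "c \<in> unit_disc" "0 < r"
  shows "measure area (ball c r \<inter> unit_disc) \<le> r\<^sup>2"
    and "r \<le> 2 \<Longrightarrow> r\<^sup>2 / 4 \<le> measure area (ball c r \<inter> unit_disc)"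
proof -
  have [measurable]: "ball c r \<inter> unit_disc \<in> sets lebesgue" by auto
  have "measure lebesgue (ball c r \<inter> unit_disc) \<le> measure lebesgue (ball c r)"
    by (intro measure_mono_fmeasurable) auto
  then show "measure area (ball c r \<inter> unit_disc) \<le> r\<^sup>2"
    using assms by (simp add: measure_area measure_lebesgue_ball field_simps)
  assume r: "r \<le> 2"
  let ?c = "(1 - r / 2) *\<^sub>R c"
  have "ball ?c (r / 2) \<subseteq> ball c r \<inter> unit_disc"
  proof safe
    fix z assume z: "z \<in> ball ?c (r / 2)"
    have "dist c ?c = r / 2 * cmod c"
      using assms(2) unfolding dist_norm
      by (simp add: algebra_simps scaleR_left_diff_distrib flip: scaleR_right_diff_distrib)
    then have "dist c ?c \<le> r / 2"
      using assms by (simp add: mult_left_le)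
    then show "z \<in> ball c r"
      using z dist_triangle[of c z ?c] by simp
    have "norm ?c \<le> 1 - r / 2"
      using assms r by (simp add: mult_left_le)
    then show "z \<in> ball 0 1"
      using z norm_triangle_ineq2[of z ?c] by (simp add: dist_norm norm_minus_commute)
  qed
  then have "measure lebesgue (ball ?c (r / 2)) \<le> measure lebesgue (ball c r \<inter> unit_disc)"
    by (intro measure_mono_fmeasurable) (auto intro!: lmeasurable_open bounded_Int)
  then show "r\<^sup>2 / 4 \<le> measure area (ball c r \<inter> unit_disc)"
    using assms by (simp add: measure_area measure_lebesgue_ball field_simps power2_eq_square)
qed

section \<open>A weak differentiation theorem\<close>

text \<open>Vitali's covering theorem fills \<open>N\<close> up to a null set with disjoint balls
  that satisfy the estimate and lie in an open set \<open>U\<close> barely larger than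
  \<open>N\<close>; adding up the estimates gives the bound. Absolute continuity makes the uncovered
  part null for \<open>\<nu>\<close> as well.\<close>

lemma measure_le_of_ball_le:
  fixes \<nu> :: "'a::euclidean_space measure"
  assumes sets_\<nu>: "sets \<nu> = sets lebesgue"
    and ac: "absolutely_continuous lebesgue \<nu>"
    and N: "N \<in> lmeasurable"
    and fine: "\<And>x d. x \<in> N \<Longrightarrow> 0 < d \<Longrightarrow>
      \<exists>r. 0 < r \<and> r < d \<and> emeasure \<nu> (ball x r) \<le> ennreal c * emeasure lebesgue (ball x r)"
    and "0 \<le> c"
  shows "emeasure \<nu> N \<le> ennreal c * emeasure lebesgue N"
proof (rule ennreal_le_epsilon)
  fix e :: real assume e: "0 < e"
  \<comment> \<open>Dividing by \<open>c + 1\<close> instead of \<open>c\<close> covers the case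
    \<open>c = 0\<close>.\<close>
  define e' where "e' = e / (c + 1)"
  have e': "0 < e'" "c * e' \<le> e"
    using e \<open>0 \<le> c\<close> by (auto simp: e'_def field_simps)
  obtain U where U: "open U" "N \<subseteq> U" "U - N \<in> lmeasurable" "emeasure lebesgue (U - N) < ennreal e'"
    using sets_lebesgue_outer_open[of N e'] N e' by auto
  define K where "K = {(x, r). x \<in> N \<and> 0 < r \<and> ball x r \<subseteq> U \<and>
    emeasure \<nu> (ball x r) \<le> ennreal c * emeasure lebesgue (ball x r)}"
  have "\<exists>i. i \<in> K \<and> x \<in> ball (fst i) (snd i) \<and> snd i < d" if xd: "x \<in> N" "0 < d" for x d
  proof -
    obtain d' where "0 < d'" "ball x d' \<subseteq> U"
      using U xd openE[of U x] by blast
    moreover obtain r where "0 < r" "r < min d d'"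
      "emeasure \<nu> (ball x r) \<le> ennreal c * emeasure lebesgue (ball x r)"
      using fine[OF xd(1), of "min d d'"] \<open>0 < d'\<close> xd by auto
    moreover have "ball x r \<subseteq> ball x d'" using \<open>r < min d d'\<close> by auto
    ultimately show ?thesis using xd by (intro exI[of _ "(x, r)"]) (auto simp: K_def)
  qed
  then obtain C where C: "countable C" "C \<subseteq> K"
     "pairwise (\<lambda>i j. disjnt (ball (fst i) (snd i)) (ball (fst j) (snd j))) C"
     "negligible (N - (\<Union>i \<in> C. ball (fst i) (snd i)))"
    using Vitali_covering_theorem_balls[of N K fst snd] by blast
  define B where "B i = ball (fst i) (snd i)" for i :: "'a \<times> real"
  define V where "V = (\<Union>i\<in>C. B i)"
  have dj: "disjoint_family_on B C"
    using C(3) by (auto simp: B_def disjoint_family_on_def pairwise_def disjnt_def)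
  have Vm: "V \<in> sets lebesgue" by (auto simp: V_def B_def C(1) intro!: sets.countable_UN'')
  have "N - V \<in> null_sets lebesgue"
    using C(4) by (simp add: V_def B_def negligible_iff_null_sets)
  then have null: "N - V \<in> null_sets \<nu>"
    using ac by (auto simp: absolutely_continuous_def)
  have "emeasure \<nu> N \<le> emeasure \<nu> (V \<union> (N - V))"
    using Vm N by (intro emeasure_mono) (auto simp: sets_\<nu>)
  also have "\<dots> = emeasure \<nu> V"
    using Vm null by (intro emeasure_Un_null_set) (auto simp: sets_\<nu>)
  also have "\<dots> = (\<integral>\<^sup>+i. emeasure \<nu> (B i) \<partial>count_space C)"
    unfolding V_def using C dj by (intro emeasure_UN_countable) (auto simp: sets_\<nu> B_def)
  also have "\<dots> \<le> (\<integral>\<^sup>+i. ennreal c * emeasure lebesgue (B i) \<partial>count_space C)"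
    using C(2) by (intro nn_integral_mono) (auto simp: B_def K_def)
  also have "\<dots> = ennreal c * emeasure lebesgue V"
    unfolding V_def using C dj
    by (subst emeasure_UN_countable) (auto simp: B_def nn_integral_cmult)
  also have "V \<subseteq> U" using C(2) by (fastforce simp: V_def B_def K_def)
  then have "emeasure lebesgue V \<le> emeasure lebesgue U"
    using U by (intro emeasure_mono) auto
  also have "emeasure lebesgue U = emeasure lebesgue N + emeasure lebesgue (U - N)"
    using U N by (subst plus_emeasure) (auto simp: Un_absorb1)
  also have "ennreal c * \<dots> \<le> ennreal c * (emeasure lebesgue N + ennreal e')"
    using U by (intro mult_left_mono add_left_mono) auto
  also have "\<dots> \<le> ennreal c * emeasure lebesgue N + ennreal e"
    using e' \<open>0 \<le> c\<close> by (simp add: distrib_left ennreal_leI flip: ennreal_mult)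
  finally show "emeasure \<nu> N \<le> ennreal c * emeasure lebesgue N + ennreal e"
    by (simp add: mult_left_mono)
qed

text \<open>Since the balls need not be centred at
  \<open>x\<close>, the exceptional set is the difference of a measurable set and an open set.\<close>

lemma AE_ball_integral_gt:
  fixes g :: "'a::euclidean_space \<Rightarrow> ennreal"
  assumes [measurable]: "g \<in> borel_measurable lebesgue" and U: "open U" and "0 < R" "0 \<le> c"
    and fin: "emeasure lebesgue {x \<in> U. ennreal c < g x} < \<infinity>"
  shows "AE x in lebesgue. x \<in> U \<and> ennreal c < g x \<longrightarrow>
    (\<exists>y r. 0 < r \<and> r \<le> R \<and> ball y r \<subseteq> U \<and> x \<in> ball y r \<and>
      ennreal c * emeasure lebesgue (ball y r) < (\<integral>\<^sup>+z\<in>ball y r. g z \<partial>lebesgue))"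
proof -
  define good where "good y r \<longleftrightarrow> 0 < r \<and> r \<le> R \<and> ball y r \<subseteq> U \<and>
      ennreal c * emeasure lebesgue (ball y r) < (\<integral>\<^sup>+z\<in>ball y r. g z \<partial>lebesgue)" for y r
  define S where "S = {x \<in> U. ennreal c < g x}"
  define N where "N = S - \<Union> {ball y r | y r. good y r}"
  have [measurable]: "U \<in> sets lebesgue" using U by auto
  have Sm[measurable]: "S \<in> sets lebesgue"
  proof -
    have "S = U \<inter> {x \<in> space lebesgue. ennreal c < g x}" by (auto simp: S_def)
    also have "\<dots> \<in> sets lebesgue" by measurable
    finally show ?thesis .
  qed
  have "open (\<Union> {ball y r | y r. good y r})" by auto
  then have Nm[measurable]: "N \<in> sets lebesgue" unfolding N_def by (intro sets.Diff Sm) auto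
  have "emeasure lebesgue N \<le> emeasure lebesgue S" by (intro emeasure_mono) (auto simp: N_def)
  then have N: "N \<in> lmeasurable"
    using fin by (intro fmeasurableI) (auto simp: S_def)
  let ?\<nu> = "density lebesgue g"
  have em: "emeasure ?\<nu> A = (\<integral>\<^sup>+z\<in>A. g z \<partial>lebesgue)" if "A \<in> sets lebesgue" for A
    using that by (simp add: emeasure_density)
  have "emeasure ?\<nu> N \<le> ennreal c * emeasure lebesgue N"
  proof (rule measure_le_of_ball_le)
    fix x and d :: real assume x: "x \<in> N" and d: "0 < d"
    then have "x \<in> U" by (auto simp: N_def S_def)
    then obtain d' where d': "0 < d'" "ball x d' \<subseteq> U" using U by (meson openE)
    define r where "r = min (min d d') R / 2"
    have r: "0 < r" "r < d" "r < d'" "r \<le> R" using d d' \<open>0 < R\<close> by (auto simp: r_def min_def)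
    then have "ball x r \<subseteq> U" using d' by force
    moreover have "\<not> good x r"
    proof
      assume "good x r"
      then have "x \<in> \<Union> {ball y r | y r. good y r}" using r by (force intro: UnionI[of "ball x r"])
      with x show False unfolding N_def by blast
    qed
    ultimately show "\<exists>r>0. r < d \<and> emeasure ?\<nu> (ball x r) \<le> ennreal c * emeasure lebesgue (ball x r)"
      using r by (intro exI[of _ r]) (auto simp: good_def em)
  qed (use N \<open>0 \<le> c\<close> in \<open>auto intro: absolutely_continuousI_density\<close>)
  then have le: "(\<integral>\<^sup>+z\<in>N. g z \<partial>lebesgue) \<le> (\<integral>\<^sup>+z\<in>N. ennreal c \<partial>lebesgue)"
    by (simp add: em nn_integral_cmult_indicator)
  \<comment> \<open>If this failed, the integral of \<open>g\<close> over \<open>N\<close> would be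
    strictly larger than that of \<open>c\<close>, because the latter is finite; this contradicts
    \<open>le\<close>. Since \<open>g\<close> exceeds \<open>c\<close> on \<open>N\<close>, almost
    no point can lie in \<open>N\<close>.\<close>
  have "AE x in lebesgue. g x * indicator N x \<le> ennreal c * indicator N x"
  proof (rule ccontr)
    assume "\<not> ?thesis"
    moreover have "AE x in lebesgue. ennreal c * indicator N x \<le> g x * indicator N x"
      by (intro AE_I2) (auto simp: N_def S_def indicator_def)
    ultimately have "(\<integral>\<^sup>+z\<in>N. ennreal c \<partial>lebesgue) < (\<integral>\<^sup>+z\<in>N. g z \<partial>lebesgue)"
      using N by (intro nn_integral_less)
        (auto simp: nn_integral_cmult_indicator ennreal_mult_eq_top_iff fmeasurable_def top_unique)
    with le show False by simp
  qed
  then show ?thesis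
  proof eventually_elim
    case (elim x)
    have "x \<notin> N"
    proof
      assume "x \<in> N"
      with elim show False by (auto simp: N_def S_def)
    qed
    then show ?case by (force simp: N_def S_def good_def)
  qed
qed


section \<open>The John--Nirenberg inequality\<close>

definition trunc_disc :: "complex \<Rightarrow> real \<Rightarrow> complex set" where
  "trunc_disc c r = ball c r \<inter> unit_disc"

lemma trunc_disc_sets [measurable, simp]: "trunc_disc c r \<in> sets area"
  by (auto simp: trunc_disc_def sets_area)

lemma trunc_disc_in_bmo_discs: "c \<in> unit_disc \<Longrightarrow> 0 < r \<Longrightarrow> trunc_disc c r \<in> bmo_discs"
  by (auto simp: bmo_discs_def trunc_disc_def)

lemma measure_trunc_disc_pos:
  assumes "c \<in> unit_disc" "0 < r"
  shows "0 < measure area (trunc_disc c r)"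
proof -
  \<comment> \<open>The lower area bound is available up to radius 2 only, hence the cap.\<close>
  have "0 < (min r 2)\<^sup>2 / 4" using assms by simp
  also have "\<dots> \<le> measure area (trunc_disc c (min r 2))"
    unfolding trunc_disc_def using assms by (intro area_disc_bounds) auto
  also have "\<dots> \<le> measure area (trunc_disc c r)"
    by (intro area.finite_measure_mono trunc_disc_sets) (auto simp: trunc_disc_def)
  finally show ?thesis .
qed

lemma set_integrable_area:
  fixes f :: "complex \<Rightarrow> real"
  assumes "integrable area f" "E \<in> sets area"
  shows "set_integrable area E f"
  using integrable_mult_indicator[OF assms(2,1)] by (simp add: set_integrable_def)

lemma abs_mean_diff_le:
  assumes f: "integrable area f" and E: "E \<in> sets area" "0 < measure area E"
    and le: "(LINT x:E|area. \<bar>f x - a\<bar>) \<le> b * measure area E"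
  shows "\<bar>mean f E - a\<bar> \<le> b"
proof -
  have int: "set_integrable area E f" "set_integrable area E (\<lambda>_. a)" "set_integrable area E (\<lambda>x. f x - a)"
    using f E by (auto intro!: set_integrable_area)
  have "(LINT x:E|area. f x - a) = (LINT x:E|area. f x) - a * measure area E"
    using int E Int_absorb2[of E unit_disc]
    by (simp add: set_integral_diff sets_area set_lebesgue_integral_def[of _ _ "\<lambda>_. a"])
  then have "mean f E - a = (LINT x:E|area. f x - a) / measure area E"
    using E by (simp add: mean_def field_simps)
  moreover have "\<bar>LINT x:E|area. f x - a\<bar> \<le> (LINT x:E|area. \<bar>f x - a\<bar>)"
    using set_integral_norm_bound[OF int(3)] by simp
  ultimately show ?thesis
    using le E by (simp only: abs_divide) (simp add: pos_divide_le_eq)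
qed

text \<open>Extending \<open>g\<close> by zero reduces the claim to Lebesgue measure, and the
  density 1 / pi cancels. The balls lie in \<open>U\<close>, hence in the disc, so none of them is
  truncated.\<close>

lemma AE_disc_integral_gt:
  fixes g :: "complex \<Rightarrow> real"
  assumes g: "integrable area g" "\<And>x. 0 \<le> g x" and U: "open U" "U \<subseteq> unit_disc"
    and "0 < R" "0 \<le> b"
  shows "AE x in area. x \<in> U \<and> b < g x \<longrightarrow>
    (\<exists>y r. 0 < r \<and> r \<le> R \<and> ball y r \<subseteq> U \<and> x \<in> ball y r \<and>
      b * measure area (ball y r) < (LINT z:ball y r|area. g z))"
proof -
  define h where "h x = ennreal (g x) * indicator unit_disc x" for x
  have [measurable]: "g \<in> borel_measurable area" using g by auto
  have hm[measurable]: "h \<in> borel_measurable lebesgue"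
    unfolding h_def by (intro measurable_area_lebesgue) measurable
  have "emeasure lebesgue {x \<in> U. ennreal b < h x} \<le> emeasure lebesgue unit_disc"
    using U by (intro emeasure_mono) auto
  also have "\<dots> < \<infinity>" by (simp add: emeasure_ball DIM_complex)
  finally have "AE x in lebesgue. x \<in> U \<and> ennreal b < h x \<longrightarrow>
    (\<exists>y r. 0 < r \<and> r \<le> R \<and> ball y r \<subseteq> U \<and> x \<in> ball y r \<and>
      ennreal b * emeasure lebesgue (ball y r) < (\<integral>\<^sup>+z\<in>ball y r. h z \<partial>lebesgue))"
    using U assms by (intro AE_ball_integral_gt) auto
  then have "AE x in area. x \<in> U \<and> ennreal b < h x \<longrightarrow>
    (\<exists>y r. 0 < r \<and> r \<le> R \<and> ball y r \<subseteq> U \<and> x \<in> ball y r \<and>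
      ennreal b * emeasure lebesgue (ball y r) < (\<integral>\<^sup>+z\<in>ball y r. h z \<partial>lebesgue))"
    by (rule AE_area)
  then show ?thesis
  proof eventually_elim
    case (elim x)
    show ?case
    proof (intro impI)
      assume x: "x \<in> U \<and> b < g x"
      then have "ennreal b < h x"
        using U \<open>0 \<le> b\<close> by (auto simp: h_def indicator_def ennreal_less_iff subset_iff)
      then obtain y r where yr: "0 < r" "r \<le> R" "ball y r \<subseteq> U" "x \<in> ball y r"
        and lt: "ennreal b * emeasure lebesgue (ball y r) < (\<integral>\<^sup>+z\<in>ball y r. h z \<partial>lebesgue)"
        using elim x by blast
      have B: "ball y r \<subseteq> unit_disc" and [measurable]: "ball y r \<in> sets area"
        using yr U by (auto simp: sets_area)
      have int: "set_integrable area (ball y r) g" using g by (intro set_integrable_area) auto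
      have "ennreal (LINT z:ball y r|area. g z) = (\<integral>\<^sup>+z. ennreal (indicator (ball y r) z * g z) \<partial>area)"
        using int g(2) unfolding set_lebesgue_integral_def set_integrable_def
        by (subst nn_integral_eq_integral) auto
      also have "\<dots> = (\<integral>\<^sup>+z\<in>ball y r. g z \<partial>area)"
        by (intro nn_integral_cong) (auto simp: indicator_def)
      also have "\<dots> = ennreal (1 / pi) * (\<integral>\<^sup>+z\<in>unit_disc. (ennreal (g z) * indicator (ball y r) z) \<partial>lebesgue)"
        by (intro nn_integral_area) measurable
      also have "(\<integral>\<^sup>+z\<in>unit_disc. (ennreal (g z) * indicator (ball y r) z) \<partial>lebesgue) =
          (\<integral>\<^sup>+z\<in>ball y r. h z \<partial>lebesgue)"
        by (intro nn_integral_cong) (auto simp: h_def indicator_def)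
      finally have eq: "ennreal (LINT z:ball y r|area. g z) =
        ennreal (1 / pi) * (\<integral>\<^sup>+z\<in>ball y r. h z \<partial>lebesgue)" .
      have "ennreal (b * measure area (ball y r)) = ennreal (1 / pi) * (ennreal b * emeasure lebesgue (ball y r))"
        using B \<open>0 \<le> b\<close> 
        by (simp add: ennreal_mult area.emeasure_eq_measure[symmetric] emeasure_area ac_simps)
      also have "\<dots> < ennreal (LINT z:ball y r|area. g z)"
        unfolding eq using lt by (intro ennreal_mult_strict_left_mono) auto
      finally have "b * measure area (ball y r) < (LINT z:ball y r|area. g z)"
        using \<open>0 \<le> b\<close> by (simp add: ennreal_less_iff)
      then show "\<exists>y r. 0 < r \<and> r \<le> R \<and> ball y r \<subseteq> U \<and> x \<in> ball y r \<and>
        b * measure area (ball y r) < (LINT z:ball y r|area. g z)" using yr by blast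
    qed
  qed
qed

lemma set_integral_le_of_mean_osc:
  assumes "mean_osc f E \<le> b" "0 < measure area E"
  shows "(LINT x:E|area. \<bar>f x - mean f E\<bar>) \<le> b * measure area E"
  using assms by (simp add: mean_osc_def mean_def field_simps)

lemma set_integral_subset_mono:
  fixes g :: "'a \<Rightarrow> real"
  assumes "set_integrable M B g" "A \<in> sets M" "A \<subseteq> B" "\<And>x. 0 \<le> g x"
  shows "(LINT x:A|M. g x) \<le> (LINT x:B|M. g x)"
proof -
  have "set_integrable M A g" by (rule set_integrable_subset[OF assms(1-3)])
  then show ?thesis
    using assms unfolding set_lebesgue_integral_def set_integrable_def
    by (intro integral_mono) (auto simp: indicator_def)
qed


lemma level_set_in_sets:
  fixes f :: "complex \<Rightarrow> real"
  assumes "integrable area f" "E \<in> sets area"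
  shows "{x \<in> E. t < \<bar>f x - a\<bar>} \<in> sets area"
proof -
  have [measurable]: "f \<in> borel_measurable area" "E \<in> sets area" using assms by auto
  have "{x \<in> E. t < \<bar>f x - a\<bar>} = {x \<in> space area. x \<in> E \<and> t < \<bar>f x - a\<bar>}"
    using assms by (auto simp: sets_area)
  also have "\<dots> \<in> sets area" by measurable
  finally show ?thesis .
qed

text \<open>The stopping balls are those on which the mean of \<open>\<bar>f - a\<bar>\<close> exceeds \<open>6400\<close>, while
  it does not on the concentric balls of ten times the radius.  The former makes their total area
  small, the latter allows to use the assumption on their fivefold enlargements, which still
  cover almost all of the level set.\<close>

lemma john_nirenberg_step:
  assumes f: "integrable area f" and osc: "\<And>E. E \<in> bmo_discs \<Longrightarrow> mean_osc f E \<le> 1"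
    and IH: "\<And>c r. c \<in> unit_disc \<Longrightarrow> 0 < r \<Longrightarrow> r \<le> 1 \<Longrightarrow>
      measure area {x \<in> trunc_disc c r. t < \<bar>f x - mean f (trunc_disc c (2 * r))\<bar>} \<le> M * r\<^sup>2"
    and t: "0 \<le> t" and M: "0 \<le> M" and c: "c \<in> unit_disc" and r: "0 < r" "r \<le> 1"
  shows "measure area {x \<in> trunc_disc c r. t + 6400 < \<bar>f x - mean f (trunc_disc c (2 * r))\<bar>}
    \<le> M / 4 * r\<^sup>2"
proof -
  define a where "a = mean f (trunc_disc c (2 * r))"
  define g where "g x = \<bar>f x - a\<bar>" for x
  have gi: "integrable area g" using f unfolding g_def by auto
  have g0: "0 \<le> g x" for x by (simp add: g_def)
  have gset: "set_integrable area E g" if "E \<in> sets area" for E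
    using gi that by (rule set_integrable_area)
  have total: "(LINT x:trunc_disc c (2 * r)|area. g x) \<le> 4 * r\<^sup>2"
  proof -
    have "(LINT x:trunc_disc c (2 * r)|area. g x) \<le> 1 * measure area (trunc_disc c (2 * r))"
      unfolding g_def a_def using c r osc trunc_disc_in_bmo_discs measure_trunc_disc_pos
      by (intro set_integral_le_of_mean_osc) auto
    also have "\<dots> \<le> (2 * r)\<^sup>2"
      using area_disc_bounds(1)[of c "2 * r"] c r by (simp add: trunc_disc_def)
    finally show ?thesis by (simp add: power_mult_distrib)
  qed
  \<comment> \<open>The ball has to meet \<open>ball c r\<close> but not to lie in it. Thus a
    tenfold enlargement that keeps its radius below \<open>r / 2\<close> inherits every clause but
    the last, and failure of \<open>P\<close> there is a bound on the mean of
    \<open>g\<close>.\<close>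
  define P where "P y \<rho> \<longleftrightarrow> y \<in> unit_disc \<and> 0 < \<rho> \<and> \<rho> \<le> r / 2 \<and> ball y \<rho> \<inter> ball c r \<noteq> {} \<and>
    6400 * measure area (trunc_disc y \<rho>) < (LINT x:trunc_disc y \<rho>|area. g x)" for y \<rho>
  have sub: "trunc_disc y \<rho> \<subseteq> trunc_disc c (2 * r)"
    if \<rho>: "\<rho> \<le> r / 2" and ne: "ball y \<rho> \<inter> ball c r \<noteq> {}" for y \<rho>
  proof
    fix z assume z: "z \<in> trunc_disc y \<rho>"
    obtain x where "dist y x < \<rho>" "dist c x < r" using ne by auto
    moreover have "dist c z \<le> dist c x + dist x y + dist y z"
      using dist_triangle[of c z x] dist_triangle[of x z y] by linarith
    ultimately have "dist c z < 2 * r" using z \<rho> by (auto simp: trunc_disc_def dist_commute)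
    then show "z \<in> trunc_disc c (2 * r)" using z by (auto simp: trunc_disc_def)
  qed
  \<comment> \<open>The area is at least \<open>\<rho>\<close> squared / 4 and the total integral at
    most 4 r^2, so the threshold 6400 = 16 * 20^2 yields exactly this radius.\<close>
  have P_small: "\<rho> \<le> r / 20" if P: "P y \<rho>" for y \<rho>
  proof -
    have y: "y \<in> unit_disc" "0 < \<rho>" "\<rho> \<le> r / 2" "ball y \<rho> \<inter> ball c r \<noteq> {}"
      using P by (auto simp: P_def)
    have "6400 * (\<rho>\<^sup>2 / 4) \<le> 6400 * measure area (trunc_disc y \<rho>)"
      using y r area_disc_bounds(2)[of y \<rho>] by (simp add: trunc_disc_def)
    also have "\<dots> \<le> (LINT x:trunc_disc y \<rho>|area. g x)" using P by (simp add: P_def)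
    also have "\<dots> \<le> (LINT x:trunc_disc c (2 * r)|area. g x)"
      using y g0 by (intro set_integral_subset_mono gset sub) auto
    finally have "\<rho>\<^sup>2 \<le> (r / 20)\<^sup>2" using total by (simp add: power_divide)
    then show ?thesis using r by (simp add: power2_le_iff_abs_le)
  qed
  define K where "K = {(y, \<rho>). P y \<rho> \<and> \<not> P y (10 * \<rho>)}"
  \<comment> \<open>Enlarging by the factor 10 as long as \<open>P\<close> persists must come to an
    end, since \<open>P\<close> bounds the radius; the last radius belongs to
    \<open>K\<close>.\<close>
  have K_ex: "\<exists>\<rho>'\<ge>\<rho>. (y, \<rho>') \<in> K" if P: "P y \<rho>" for y \<rho>
  proof (rule ccontr)
    assume no: "\<not> ?thesis"
    have \<rho>: "0 < \<rho>" using P by (simp add: P_def)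
    have all: "P y (10 ^ n * \<rho>)" for n
    proof (induction n)
      case (Suc n)
      have "\<rho> \<le> 10 ^ n * \<rho>" using \<rho> by simp
      with no Suc show ?case by (auto simp: K_def mult.assoc)
    qed (simp add: P)
    obtain n where "r / 20 / \<rho> < 10 ^ n" using real_arch_pow[of 10] by auto
    then have "r / 20 < 10 ^ n * \<rho>" using \<rho> by (simp add: divide_less_eq)
    with P_small[OF all[of n]] show False by simp
  qed
  have K_mean: "\<bar>mean f (trunc_disc y (10 * \<rho>)) - a\<bar> \<le> 6400" if K: "(y, \<rho>) \<in> K" for y \<rho>
  proof (rule abs_mean_diff_le[OF f])
    have P: "P y \<rho>" and nP: "\<not> P y (10 * \<rho>)" using K by (auto simp: K_def)
    have *: "y \<in> unit_disc" "0 < \<rho>" "10 * \<rho> \<le> r / 2" using P P_small[OF P] by (auto simp: P_def)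
    have "ball y \<rho> \<subseteq> ball y (10 * \<rho>)" using * by auto
    then have "ball y (10 * \<rho>) \<inter> ball c r \<noteq> {}" using P by (auto simp: P_def)
    with * nP have "(LINT x:trunc_disc y (10 * \<rho>)|area. g x) \<le> 6400 * measure area (trunc_disc y (10 * \<rho>))"
      by (auto simp: P_def)
    then show "(LINT x:trunc_disc y (10 * \<rho>)|area. \<bar>f x - a\<bar>) \<le> 6400 * measure area (trunc_disc y (10 * \<rho>))"
      by (simp add: g_def)
    show "0 < measure area (trunc_disc y (10 * \<rho>))" using * by (intro measure_trunc_disc_pos) auto
  qed simp
  define S where "S = {x \<in> trunc_disc c r. t + 6400 < g x}"
  have S_sets: "S \<in> sets area" unfolding S_def g_def by (intro level_set_in_sets f) simp
  have "AE x in area. x \<in> ball c r \<inter> unit_disc \<and> 6400 < g x \<longrightarrow>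
    (\<exists>y \<rho>. 0 < \<rho> \<and> \<rho> \<le> r / 2 \<and> ball y \<rho> \<subseteq> ball c r \<inter> unit_disc \<and> x \<in> ball y \<rho> \<and>
      6400 * measure area (ball y \<rho>) < (LINT z:ball y \<rho>|area. g z))"
    using gi g0 r by (intro AE_disc_integral_gt) auto
  then have "AE x in area. x \<in> S \<longrightarrow> (\<exists>i\<in>K. x \<in> ball (fst i) (snd i))"
  proof eventually_elim
    case (elim x)
    show ?case
    proof
      assume "x \<in> S"
      then have "x \<in> ball c r \<inter> unit_disc \<and> 6400 < g x" using t by (auto simp: S_def trunc_disc_def)
      then obtain y \<rho> where yr: "0 < \<rho>" "\<rho> \<le> r / 2" "ball y \<rho> \<subseteq> ball c r \<inter> unit_disc" "x \<in> ball y \<rho>"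
        "6400 * measure area (ball y \<rho>) < (LINT z:ball y \<rho>|area. g z)"
        using elim by blast
      have "y \<in> ball y \<rho>" using yr by simp
      then have y: "y \<in> unit_disc" using yr by blast
      have eq: "trunc_disc y \<rho> = ball y \<rho>" using yr by (auto simp: trunc_disc_def)
      have "x \<in> ball y \<rho> \<inter> ball c r" using yr by blast
      then have "P y \<rho>" unfolding P_def eq using yr y by blast
      then obtain \<rho>' where "\<rho>' \<ge> \<rho>" "(y, \<rho>') \<in> K" using K_ex by blast
      moreover have "x \<in> ball y \<rho>'" using yr \<open>\<rho>' \<ge> \<rho>\<close> by auto
      ultimately show "\<exists>i\<in>K. x \<in> ball (fst i) (snd i)" by force
    qed
  qed
  then obtain Z where Z: "{x \<in> space area. \<not> (x \<in> S \<longrightarrow> (\<exists>i\<in>K. x \<in> ball (fst i) (snd i)))} \<subseteq> Z"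
    "Z \<in> null_sets area"
    unfolding eventually_ae_filter by blast
  have SZ: "S - Z \<subseteq> (\<Union>i\<in>K. ball (fst i) (snd i))"
  proof
    fix x assume x: "x \<in> S - Z"
    then have "x \<in> space area" using S_sets by (auto simp: sets_area)
    then show "x \<in> (\<Union>i\<in>K. ball (fst i) (snd i))" using x Z(1) by blast
  qed
  have K_rad: "0 < snd i \<and> snd i \<le> r" if "i \<in> K" for i
  proof -
    have "P (fst i) (snd i)" using that by (auto simp: K_def)
    then show ?thesis using r by (simp add: P_def)
  qed
  obtain C where C: "countable C" "C \<subseteq> K"
     "pairwise (\<lambda>i j. disjnt (ball (fst i) (snd i)) (ball (fst j) (snd j))) C"
     "S - Z \<subseteq> (\<Union>i\<in>C. ball (fst i) (5 * snd i))"
    by (rule Vitali_covering_lemma_balls[OF SZ K_rad]) (assumption, rule that)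
  define T where "T i = {x \<in> trunc_disc (fst i) (5 * snd i). t < \<bar>f x - mean f (trunc_disc (fst i) (10 * snd i))\<bar>}"
    for i
  have T_sets: "T i \<in> sets area" for i unfolding T_def by (intro level_set_in_sets f) simp
  \<comment> \<open>The increment 6400 of the level pays for replacing \<open>a\<close> by the mean
    over the tenfold enlargement, which is the doubled disc of the fivefold one and hence the mean
    occurring in \<open>IH\<close>.\<close>
  have cover: "S - Z \<subseteq> (\<Union>i\<in>C. T i)"
  proof
    fix x assume x: "x \<in> S - Z"
    then obtain i where i: "i \<in> C" "x \<in> ball (fst i) (5 * snd i)" using C(4) by blast
    have "t + 6400 < \<bar>f x - a\<bar>" using x by (auto simp: S_def g_def)
    moreover have "\<bar>mean f (trunc_disc (fst i) (10 * snd i)) - a\<bar> \<le> 6400"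
      using i C(2) K_mean[of "fst i" "snd i"] by auto
    ultimately have "t < \<bar>f x - mean f (trunc_disc (fst i) (10 * snd i))\<bar>" by linarith
    then have "x \<in> T i" using x i by (auto simp: T_def S_def trunc_disc_def)
    then show "x \<in> (\<Union>i\<in>C. T i)" using i by blast
  qed
  \<comment> \<open>The fivefold radius gives a factor 25 and the lower area bound a factor 4;
    division by 6400 leaves 1 / 64.\<close>
  have T_meas: "measure area (T i) \<le> M / 64 * (LINT x:trunc_disc (fst i) (snd i)|area. g x)" if "i \<in> C" for i
  proof -
    have "(fst i, snd i) \<in> K" using that C by auto
    then have P: "P (fst i) (snd i)" by (auto simp: K_def)
    then have *: "fst i \<in> unit_disc" "0 < snd i" "snd i \<le> r / 20" using P_small[OF P] by (auto simp: P_def)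
    have "measure area (T i) \<le> M * (5 * snd i)\<^sup>2"
      unfolding T_def using IH[of "fst i" "5 * snd i"] * r by (simp add: mult.assoc)
    also have "\<dots> = M * (100 * ((snd i)\<^sup>2 / 4))" by (simp add: power_mult_distrib)
    also have "\<dots> \<le> M * (100 * measure area (trunc_disc (fst i) (snd i)))"
      using * r M area_disc_bounds(2)[of "fst i" "snd i"] by (intro mult_left_mono) (auto simp: trunc_disc_def)
    also have "\<dots> \<le> M * (1 / 64 * (LINT x:trunc_disc (fst i) (snd i)|area. g x))"
      using P M by (intro mult_left_mono) (auto simp: P_def)
    finally show ?thesis by simp
  qed
  have "measure area (\<Union>i\<in>C. T i) \<le> M / 64 * (4 * r\<^sup>2)"
  proof (rule measure_UN_bound[OF C(1)])
    fix F assume F: "F \<subseteq> C" "finite F"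
    have dj: "disjoint_family_on (\<lambda>i. trunc_disc (fst i) (snd i)) F"
      using C(3) F unfolding disjoint_family_on_def pairwise_def disjnt_def trunc_disc_def by blast
    have "measure area (\<Union>i\<in>F. T i) \<le> (\<Sum>i\<in>F. measure area (T i))"
      using F T_sets by (intro measure_UNION_le) auto
    also have "\<dots> \<le> (\<Sum>i\<in>F. M / 64 * (LINT x:trunc_disc (fst i) (snd i)|area. g x))"
      using F by (intro sum_mono T_meas) auto
    also have "\<dots> = M / 64 * (LINT x:(\<Union>i\<in>F. trunc_disc (fst i) (snd i))|area. g x)"
      using F dj by (subst set_integral_finite_Union) (auto simp: sum_distrib_left intro: gset)
    also have "\<dots> \<le> M / 64 * (LINT x:trunc_disc c (2 * r)|area. g x)"
    proof (intro mult_left_mono set_integral_subset_mono gset)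
      show "(\<Union>i\<in>F. trunc_disc (fst i) (snd i)) \<subseteq> trunc_disc c (2 * r)"
      proof (intro UN_least sub)
        fix i assume "i \<in> F"
        then have "(fst i, snd i) \<in> K" using F C by auto
        then show "snd i \<le> r / 2" "ball (fst i) (snd i) \<inter> ball c r \<noteq> {}" by (auto simp: K_def P_def)
      qed
    qed (use F M g0 in auto)
    also have "\<dots> \<le> M / 64 * (4 * r\<^sup>2)" using total M by (intro mult_left_mono) auto
    finally show "measure area (\<Union>i\<in>F. T i) \<le> M / 64 * (4 * r\<^sup>2)" .
  qed (use T_sets in \<open>auto simp: area.fmeasurable_eq_sets\<close>)
  moreover have "measure area S = measure area (S - Z)"
    using Z(2) S_sets by (simp add: measure_Diff_null_set)
  moreover have "measure area (S - Z) \<le> measure area (\<Union>i\<in>C. T i)"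
    using cover T_sets C(1) by (intro area.finite_measure_mono) auto
  \<comment> \<open>The covering yields even \<open>M / 16\<close>. The claimed factor 1 / 4 is
    small enough to beat the weights 2^k in the exponential integral.\<close>
  moreover have "M / 64 * (4 * r\<^sup>2) \<le> M / 4 * r\<^sup>2" using M by (simp add: mult_right_mono)
  ultimately show ?thesis by (simp add: S_def g_def a_def)
qed

text \<open>The induction on \<open>k\<close> runs over all discs at once, because each step applies
  the previous level to enlarged stopping discs elsewhere. At level 0 only the area bound is
  used.\<close>

lemma john_nirenberg_level:
  assumes f: "integrable area f" and osc: "\<And>E. E \<in> bmo_discs \<Longrightarrow> mean_osc f E \<le> 1"
    and "c \<in> unit_disc" "0 < r" "r \<le> 1"
  shows "measure area {x \<in> trunc_disc c r. 6400 * real k < \<bar>f x - mean f (trunc_disc c (2 * r))\<bar>}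
    \<le> (1 / 4) ^ k * r\<^sup>2"
  using assms(3-)
proof (induction k arbitrary: c r)
  case 0
  have "measure area {x \<in> trunc_disc c r. 6400 * real 0 < \<bar>f x - mean f (trunc_disc c (2 * r))\<bar>}
    \<le> measure area (trunc_disc c r)"
    by (intro area.finite_measure_mono) auto
  also have "\<dots> \<le> r\<^sup>2" using 0 by (simp add: trunc_disc_def area_disc_bounds)
  finally show ?case by simp
next
  case (Suc k)
  have eqs: "6400 * real (Suc k) = 6400 * real k + 6400" "(1 / 4) ^ Suc k * r\<^sup>2 = (1 / 4) ^ k / 4 * r\<^sup>2"
    by simp_all
  show ?case
    unfolding eqs by (rule john_nirenberg_step; (fact f osc Suc.IH Suc.prems | simp))
qed

text \<open>A discrete layer cake formula: the term with \<open>real k < u\<close> and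
  \<open>u \<le> real (Suc k)\<close> alone dominates, and the summand 1 serves
  \<open>u = 0\<close>, where all terms vanish.\<close>

lemma powr_le_suminf_indicator:
  fixes u :: real
  assumes "0 \<le> u"
  shows "ennreal (2 powr u) \<le> 1 + (\<Sum>k. ennreal (2 ^ Suc k) * of_bool (real k < u))"
proof (cases "u = 0")
  case False
  define k where "k = nat (\<lceil>u\<rceil> - 1)"
  have "0 < \<lceil>u\<rceil>" using False assms by simp
  then have "real k = real_of_int \<lceil>u\<rceil> - 1" by (simp add: k_def)
  then have k: "real k < u" "u \<le> real (Suc k)" by linarith+
  have "2 powr u \<le> 2 powr real (Suc k)" using k by (intro powr_mono) auto
  also have "\<dots> = 2 ^ Suc k" by (subst powr_realpow) auto
  finally have "ennreal (2 powr u) \<le> ennreal (2 ^ Suc k) * of_bool (real k < u)"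
    using k by (simp add: ennreal_leI del: power_Suc)
  also have "\<dots> = (\<Sum>i\<in>{k}. ennreal (2 ^ Suc i) * of_bool (real i < u))" by simp
  also have "\<dots> \<le> (\<Sum>k. ennreal (2 ^ Suc k) * of_bool (real k < u))"
    by (intro sum_le_suminf) (auto intro: summableI)
  also have "\<dots> \<le> 1 + \<dots>" by (rule add_increasing) auto
  finally show ?thesis .
qed simp

text \<open>Level \<open>k\<close> has weight 2 * 2^k and area at most 4^(-k) r^2, so that the
  levels add up to 4 r^2; the remaining r^2 is the bound for the area of the disc itself.\<close>

lemma john_nirenberg_powr:
  assumes f: "integrable area f" and osc: "\<And>E. E \<in> bmo_discs \<Longrightarrow> mean_osc f E \<le> 1"
    and c: "c \<in> unit_disc" and r: "0 < r" "r \<le> 1"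
  shows "(\<integral>\<^sup>+x\<in>trunc_disc c r. ennreal (2 powr (\<bar>f x - mean f (trunc_disc c (2 * r))\<bar> / 6400)) \<partial>area)
    \<le> ennreal (5 * r\<^sup>2)"
proof -
  define a where "a = mean f (trunc_disc c (2 * r))"
  define u where "u x = \<bar>f x - a\<bar> / 6400" for x
  let ?S = "\<lambda>k. {x \<in> trunc_disc c r. real k < u x}"
  have S: "?S k = {x \<in> trunc_disc c r. 6400 * real k < \<bar>f x - a\<bar>}" for k
    by (auto simp: u_def field_simps)
  have S_sets[measurable]: "?S k \<in> sets area" for k
    unfolding S by (intro level_set_in_sets f) simp
  have "(\<integral>\<^sup>+x\<in>trunc_disc c r. ennreal (2 powr (u x)) \<partial>area) \<le>
    (\<integral>\<^sup>+x. indicator (trunc_disc c r) x + (\<Sum>k. ennreal (2 ^ Suc k) * indicator (?S k) x) \<partial>area)"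
  proof (intro nn_integral_mono)
    fix x
    show "ennreal (2 powr (u x)) * indicator (trunc_disc c r) x \<le>
      indicator (trunc_disc c r) x + (\<Sum>k. ennreal (2 ^ Suc k) * indicator (?S k) x)"
      using powr_le_suminf_indicator[of "u x"]
      by (cases "x \<in> trunc_disc c r") (auto simp: u_def indicator_def of_bool_def)
  qed
  also have "\<dots> = emeasure area (trunc_disc c r) + (\<Sum>k. ennreal (2 ^ Suc k) * emeasure area (?S k))"
    by (simp add: nn_integral_add nn_integral_suminf nn_integral_cmult_indicator del: power_Suc)
  also have "\<dots> \<le> ennreal (r\<^sup>2) + (\<Sum>k. ennreal (2 * r\<^sup>2 * (1 / 2) ^ k))"
  proof (intro add_mono suminf_le)
    show "emeasure area (trunc_disc c r) \<le> ennreal (r\<^sup>2)"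
      using c r area_disc_bounds(1)[of c r]
      by (simp add: area.emeasure_eq_measure trunc_disc_def ennreal_leI)
    fix k
    have "ennreal (2 ^ Suc k) * emeasure area (?S k) = ennreal (2 ^ Suc k * measure area (?S k))"
      by (simp add: area.emeasure_eq_measure ennreal_mult del: power_Suc)
    also have "\<dots> \<le> ennreal (2 ^ Suc k * ((1 / 4) ^ k * r\<^sup>2))"
      unfolding S a_def using john_nirenberg_level[OF f osc c r]
      by (intro ennreal_leI mult_left_mono) auto
    also have "2 ^ Suc k * ((1 / 4) ^ k * r\<^sup>2) = 2 * r\<^sup>2 * (1 / 2) ^ k"
    proof -
      have "(2::real) ^ k * (1 / 4) ^ k = (1 / 2) ^ k" by (subst power_mult_distrib[symmetric]) simp
      then show ?thesis by simp
    qed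
    finally show "ennreal (2 ^ Suc k) * emeasure area (?S k) \<le> ennreal (2 * r\<^sup>2 * (1 / 2) ^ k)" .
  qed auto
  also have "(\<Sum>k. ennreal (2 * r\<^sup>2 * (1 / 2) ^ k)) = ennreal (2 * r\<^sup>2 * 2)"
    using sums_mult[OF geometric_sums[of "1 / 2 :: real"], of "2 * r\<^sup>2"]
    by (intro suminf_ennreal_eq) auto
  also have "ennreal (r\<^sup>2) + \<dots> = ennreal (5 * r\<^sup>2)" by (subst ennreal_plus[symmetric]) auto
  finally show ?thesis by (simp add: u_def a_def)
qed


section \<open>Carleson squares\<close>

text \<open>The image of \<open>J\<close> arises from the compact arc over \<open>{a..b}\<close> by
  removing at most the two end points.\<close>

lemma arc_borel:
  assumes "{a<..<b} \<subseteq> J" "J \<subseteq> {a..b}"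
  shows "cis ` J \<in> sets borel"
proof -
  let ?F = "cis ` {a..b} - cis ` J"
  have "{a..b} - J \<subseteq> {a, b}" using assms by force
  then have "?F \<subseteq> cis ` {a, b}" by blast
  then have "finite ?F" by (rule finite_subset) simp
  moreover have "closed (cis ` {a..b})"
    by (intro compact_imp_closed compact_continuous_image continuous_intros) auto
  moreover have "cis ` J = cis ` {a..b} - ?F" using assms by auto
  ultimately show ?thesis by (metis borel_closed finite_imp_closed sets.Diff)
qed

text \<open>An arc with \<open>b > 2 * pi\<close> passes through the point 1, and its parameters in
  \<open>{0..<2 * pi}\<close> then form two intervals. Up to end points the preimage is thus the
  union of (a, min b (2 pi)) and (0, b - 2 pi); it is squeezed between the open and the closed
  version of this union.\<close>

lemma measure_arc_normalized:
  assumes ab: "0 \<le> a" "a < 2 * pi" "a < b" "b \<le> a + 2 * pi" and J: "{a<..<b} \<subseteq> J" "J \<subseteq> {a..b}"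
  shows "measure circle_measure (cis ` J) = b - a"
proof -
  let ?S = "cis -` (cis ` J) \<inter> {0..<2 * pi}"
  have [measurable]: "cis \<in> borel_measurable borel"
    by (intro borel_measurable_continuous_onI continuous_intros)
  have S_sets: "?S \<in> sets lborel"
    using measurable_sets[of cis borel borel "cis ` J"] arc_borel[OF J] by auto
  have "emeasure circle_measure (cis ` J) = emeasure (restrict_space lborel {0..<2 * pi})
      (cis -` (cis ` J) \<inter> space (restrict_space lborel {0..<2 * pi}))"
    unfolding circle_measure_def
    using arc_borel[OF J] by (intro emeasure_distr) (auto intro!: measurable_restrict_space1)
  also have "\<dots> = emeasure lborel ?S"
    by (subst emeasure_restrict_space) (auto simp: space_restrict_space)
  finally have eq: "measure circle_measure (cis ` J) = measure lborel ?S"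
    by (simp add: measure_def)
  let ?L = "{a<..<min b (2 * pi)} \<union> {0<..<b - 2 * pi}"
  let ?U = "{a..min b (2 * pi)} \<union> {0..b - 2 * pi}"
  have shift: "cis (t + 2 * pi) = cis t" for t by (simp add: cis_mult[symmetric])
  have "?L \<subseteq> ?S"
  proof
    fix t assume "t \<in> ?L"
    then consider "a < t" "t < b" "t < 2 * pi" | "0 < t" "t < b - 2 * pi" by auto
    then show "t \<in> ?S"
    proof cases
      case 1
      with J ab show ?thesis by auto
    next
      case 2
      then have "t + 2 * pi \<in> J" using J ab by auto
      moreover have "t < 2 * pi" using 2 ab by linarith
      moreover have "cis t = cis (t + 2 * pi)" by (rule shift[symmetric])
      ultimately show ?thesis using 2 by (intro IntI vimageI2) (auto intro: image_eqI)
    qed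
  qed
  moreover have "?S \<subseteq> ?U"
  proof
    fix t assume t: "t \<in> ?S"
    then obtain s where s: "s \<in> J" "cis t = cis s" by auto
    then have "sin t = sin s \<and> cos t = cos s" by (simp add: complex_eq_iff)
    then obtain n :: int where n: "t = s + 2 * pi * n"
      using sin_cos_eq_iff[of t s] by (auto simp: Ints_def)
    have "a \<le> s" "s \<le> b" using s J by auto
    \<comment> \<open>Here \<open>s\<close> lies in [0, 4 pi) and \<open>t\<close> in [0, 2 pi),
      which leaves only the shifts 0 and -1.\<close>
    then have "2 * pi * (-2) < 2 * pi * real_of_int n" "2 * pi * real_of_int n < 2 * pi * 1" 
    proof -
      have "0 \<le> t" "t < 2 * pi" using t by auto
      then show "2 * pi * (-2) < 2 * pi * real_of_int n" "2 * pi * real_of_int n < 2 * pi * 1"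
        using n ab \<open>a \<le> s\<close> \<open>s \<le> b\<close> by linarith+
    qed
    then have "- 2 < real_of_int n" "real_of_int n < 1"
      by (auto simp only: mult_less_cancel_left_pos pi_gt_zero mult_pos_pos zero_less_numeral)
    then have "n = 0 \<or> n = -1" by linarith
    then show "t \<in> ?U" using n t \<open>a \<le> s\<close> \<open>s \<le> b\<close> by auto
  qed
  moreover have "measure lborel ?L = b - a"
  proof -
    have "emeasure lborel {0<..<b - 2 * pi} \<noteq> top" by (cases "b \<le> 2 * pi") auto
    then show ?thesis using ab by (subst measure_Union) (auto simp: min_def)
  qed
  moreover have "measure lborel ?U \<le> b - a"
    using ab measure_Un_le[of "{a..min b (2 * pi)}" lborel "{0..b - 2 * pi}"]
    by (cases "b \<le> 2 * pi") (auto simp: min_def split: if_splits)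
  moreover have "?L \<in> fmeasurable lborel" "?U \<in> fmeasurable lborel" by (intro fmeasurableI emeasure_bounded_finite; simp)+
  ultimately have "b - a \<le> measure lborel ?S" "measure lborel ?S \<le> b - a"
    using S_sets measure_mono_fmeasurable[of ?L ?S lborel] measure_mono_fmeasurable[of ?S ?U lborel]
      fmeasurableI2[of ?U lborel ?S] by auto
  then show ?thesis by (simp add: eq)
qed

lemma measure_arc:
  assumes ab: "a < b" "b \<le> a + 2 * pi" and J: "{a<..<b} \<subseteq> J" "J \<subseteq> {a..b}"
  shows "measure circle_measure (cis ` J) = b - a"
proof -
  define k where "k = \<lfloor>a / (2 * pi)\<rfloor>"
  define d where "d = 2 * pi * real_of_int k"
  have "real_of_int k \<le> a / (2 * pi)" "a / (2 * pi) < real_of_int k + 1"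
    by (auto simp: k_def)
  then have d: "0 \<le> a - d" "a - d < 2 * pi"
    by (auto simp: d_def field_simps)
  have "cis (x - d) = cis x" for x
    by (simp add: d_def flip: cis_divide)
  then have "cis ` J = cis ` ((\<lambda>x. x - d) ` J)" by (simp add: image_image)
  also have "measure circle_measure \<dots> = (b - d) - (a - d)"
  proof (rule measure_arc_normalized)
    show "{a - d<..<b - d} \<subseteq> (\<lambda>x. x - d) ` J"
    proof
      fix x assume "x \<in> {a - d<..<b - d}"
      then have "x + d \<in> J" using J by auto
      then show "x \<in> (\<lambda>x. x - d) ` J" by force
    qed
  qed (use ab J d in auto)
  finally show ?thesis by simp
qed

text \<open>In polar coordinates a Carleson square is a rectangle, with the same length
  \<open>b - a\<close> limiting angle and depth. All geometric estimates below start from this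
  form.\<close>

lemma carleson_square_arc:
  assumes "a < b" "b \<le> a + 2 * pi" "{a<..<b} \<subseteq> J" "J \<subseteq> {a..b}"
  shows "carleson_square (cis ` J) =
    {of_real r * cis t | r t. 0 < r \<and> r < 1 \<and> 1 - r < b - a \<and> t \<in> J}"
proof (intro equalityI subsetI)
  fix z assume "z \<in> carleson_square (cis ` J)"
  then have z: "cmod z < 1" "z \<noteq> 0" "1 - cmod z < b - a" "z / of_real (cmod z) \<in> cis ` J"
    using measure_arc[OF assms] by (auto simp: carleson_square_def)
  then obtain t where "t \<in> J" "z / of_real (cmod z) = cis t" by blast
  moreover from this z have "z = of_real (cmod z) * cis t" by (simp add: field_simps)
  ultimately show "z \<in> {of_real r * cis t | r t. 0 < r \<and> r < 1 \<and> 1 - r < b - a \<and> t \<in> J}"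
    using z by (intro CollectI exI[of _ "cmod z"] exI[of _ t]) simp
next
  fix z assume "z \<in> {of_real r * cis t | r t. 0 < r \<and> r < 1 \<and> 1 - r < b - a \<and> t \<in> J}"
  then obtain r t where "z = of_real r * cis t" "0 < r" "r < 1" "1 - r < b - a" "t \<in> J" by blast
  then show "z \<in> carleson_square (cis ` J)"
    using measure_arc[OF assms] by (auto simp: carleson_square_def norm_mult)
qed

lemma carleson_square_in_sets:
  assumes "Q \<in> carleson_squares"
  shows "Q \<in> sets area"
proof -
  obtain J a b where J: "{a<..<b} \<subseteq> J" "J \<subseteq> {a..b}" and Q: "Q = carleson_square (cis ` J)"
    using assms by (auto simp: carleson_squares_def arcs_def)
  have [measurable]: "cis ` J \<in> sets borel" using J by (rule arc_borel)
  have "{z \<in> space borel. z \<noteq> 0 \<and> cmod z < 1 \<and> z / of_real (cmod z) \<in> cis ` J \<and>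
    1 - cmod z < measure circle_measure (cis ` J)} \<in> sets borel"
    by measurable
  also have "{z \<in> space borel. z \<noteq> 0 \<and> cmod z < 1 \<and> z / of_real (cmod z) \<in> cis ` J \<and>
    1 - cmod z < measure circle_measure (cis ` J)} = Q"
    by (auto simp: Q carleson_square_def)
  finally have "Q \<in> sets lebesgue" by simp
  then show ?thesis by (auto simp: sets_area Q carleson_square_def)
qed

section \<open>Comparison of Carleson squares with discs\<close>

lemma norm_cis_diff_le: "cmod (cis s - cis t) \<le> \<bar>s - t\<bar>"
proof -
  have "cis s - cis t = cis t * (cis (s - t) - 1)" by (simp add: cis_mult right_diff_distrib)
  then have "cmod (cis s - cis t) = cmod (exp (\<i> * of_real (s - t)) - 1)"
    by (simp add: norm_mult cis_conv_exp)
  also have "\<dots> = 2 * \<bar>sin ((s - t) / 2)\<bar>" by (rule dist_exp_i_1)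
  also have "\<dots> \<le> \<bar>s - t\<bar>" using abs_sin_x_le_abs_x[of "(s - t) / 2"] by simp
  finally show ?thesis .
qed

text \<open>Rotation by \<open>- m\<close> moves the centre to the positive real axis. The rotated
  point has positive real part, so its argument is an arctangent and at most |Im w| / Re w in
  absolute value.\<close>

lemma polar_near:
  assumes z: "cmod (z - of_real \<rho> * cis m) < \<delta>" and \<delta>: "\<delta> < \<rho>"
  obtains t where "\<bar>t - m\<bar> \<le> \<delta> / (\<rho> - \<delta>)" "z = of_real (cmod z) * cis t" "\<bar>cmod z - \<rho>\<bar> < \<delta>"
proof
  define w where "w = z * cis (- m)"
  have zw: "z = w * cis m" by (simp add: w_def cis_mult mult.assoc)
  have "z - of_real \<rho> * cis m = (w - of_real \<rho>) * cis m" by (simp add: zw algebra_simps)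
  then have w: "cmod (w - of_real \<rho>) < \<delta>" using z by (simp add: norm_mult)
  have "0 < \<delta>" using w norm_ge_zero[of "w - of_real \<rho>"] by linarith
  have Re: "\<rho> - \<delta> < Re w" using abs_Re_le_cmod[of "w - of_real \<rho>"] w by simp
  have Im: "\<bar>Im w\<bar> \<le> \<delta>" using abs_Im_le_cmod[of "w - of_real \<rho>"] w by simp
  have pos: "0 < Re w" using Re \<delta> by linarith
  then have "\<bar>Arg w\<bar> = \<bar>arctan (Im w / Re w)\<bar>" by (simp add: arg_conv_arctan)
  also have "\<dots> \<le> \<bar>Im w / Re w\<bar>" by (rule abs_arctan_le)
  also have "\<dots> = \<bar>Im w\<bar> / Re w" using pos by (simp add: abs_divide)
  also have "\<dots> \<le> \<delta> / (\<rho> - \<delta>)" using Im Re \<delta> \<open>0 < \<delta>\<close> by (intro frac_le) auto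
  finally show "\<bar>(m + Arg w) - m\<bar> \<le> \<delta> / (\<rho> - \<delta>)" by simp
  have "w \<noteq> 0" using pos by auto
  then have "w = of_real (cmod w) * cis (Arg w)" by (simp add: cis_Arg sgn_eq)
  then show "z = of_real (cmod z) * cis (m + Arg w)"
    by (simp add: zw norm_mult cis_mult[symmetric])
  have "\<bar>cmod w - \<bar>\<rho>\<bar>\<bar> \<le> cmod (w - of_real \<rho>)"
    using norm_triangle_ineq3[of w "of_real \<rho>"] by simp
  then show "\<bar>cmod z - \<rho>\<bar> < \<delta>" using w \<delta> \<open>0 < \<delta>\<close> by (simp add: zw norm_mult)
qed

text \<open>The witness is the middle of the square, at radius \<open>1 - h / 2\<close> and angle
  \<open>m\<close>; every point of the square differs from it by at most \<open>h / 2\<close> in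
  radius and in angle.\<close>

lemma carleson_square_subset_disc:
  assumes ab: "a < b" "b - a \<le> 1 / 2" and J: "{a<..<b} \<subseteq> J" "J \<subseteq> {a..b}"
  shows "\<exists>c\<in>unit_disc. carleson_square (cis ` J) \<subseteq> trunc_disc c (2 * (b - a))"
proof -
  define h where "h = b - a"
  have h: "0 < h" "h \<le> 1 / 2" using ab by (auto simp: h_def)
  define m where "m = (a + b) / 2"
  define c where "c = of_real (1 - h / 2) * cis m"
  have "b \<le> a + 2 * pi" using ab pi_ge_two by linarith
  note sq = carleson_square_arc[OF ab(1) this J]
  have "c \<in> unit_disc" using h by (simp add: c_def norm_mult del: of_real_diff of_real_divide)
  moreover have "carleson_square (cis ` J) \<subseteq> trunc_disc c (2 * h)"
  proof
    fix z assume "z \<in> carleson_square (cis ` J)"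
    then obtain r t where z: "z = of_real r * cis t" "0 < r" "r < 1" "1 - r < h" "t \<in> J"
      unfolding sq h_def by blast
    have "\<bar>t - m\<bar> \<le> h / 2" using z J by (auto simp: m_def h_def abs_if field_simps subset_iff)
    have "z - c = of_real (r - (1 - h / 2)) * cis t + of_real (1 - h / 2) * (cis t - cis m)"
      by (simp add: z c_def field_simps)
    then have "cmod (z - c) \<le> \<bar>r - (1 - h / 2)\<bar> + \<bar>1 - h / 2\<bar> * cmod (cis t - cis m)"
      by (metis norm_triangle_ineq norm_mult norm_of_real norm_cis mult.right_neutral)
    also have "\<bar>1 - h / 2\<bar> * cmod (cis t - cis m) \<le> 1 * (h / 2)"
      using h \<open>\<bar>t - m\<bar> \<le> h / 2\<close> norm_cis_diff_le[of t m] by (intro mult_mono) auto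
    also have "\<bar>r - (1 - h / 2)\<bar> \<le> h / 2" using z by (auto simp: abs_if)
    finally have "cmod (z - c) < 2 * h" using h by linarith
    then show "z \<in> trunc_disc c (2 * h)"
      using z by (simp add: trunc_disc_def dist_norm norm_minus_commute norm_mult)
  qed
  ultimately show ?thesis by (auto simp: h_def)
qed

text \<open>A ball of radius \<open>h / 8\<close> about the point at depth \<open>h / 2\<close> over
  the midpoint of the arc fits into the square. The parameter \<open>h\<close> is separate from
  \<open>b - a\<close> because arcs may be longer than the radius of the disc.\<close>

lemma carleson_square_measure_ge:
  assumes ab: "a < b" "b \<le> a + 2 * pi" and J: "{a<..<b} \<subseteq> J" "J \<subseteq> {a..b}"
    and h: "0 < h" "h \<le> 1" "h \<le> b - a"
  shows "(h / 8)\<^sup>2 \<le> measure area (carleson_square (cis ` J))"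
proof -
  define m where "m = (a + b) / 2"
  define c where "c = of_real (1 - h / 2) * cis m"
  note sq = carleson_square_arc[OF ab J]
  have Q: "carleson_square (cis ` J) \<in> sets area"
    using ab J by (intro carleson_square_in_sets) (auto simp: carleson_squares_def arcs_def)
  have sub: "ball c (h / 8) \<subseteq> carleson_square (cis ` J)"
  proof
    fix z assume "z \<in> ball c (h / 8)"
    then have "cmod (z - of_real (1 - h / 2) * cis m) < h / 8"
      by (simp add: c_def dist_norm norm_minus_commute)
    then obtain t where t: "\<bar>t - m\<bar> \<le> (h / 8) / ((1 - h / 2) - h / 8)"
      "z = of_real (cmod z) * cis t" "\<bar>cmod z - (1 - h / 2)\<bar> < h / 8"
      using polar_near[of z "1 - h / 2" m "h / 8"] h by auto
    \<comment> \<open>With \<open>h \<le> 1\<close> the denominator is at least 3 / 8, so the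
      angular deviation is at most \<open>h / 3\<close>, less than half the arc.\<close>
    have "(h / 8) / ((1 - h / 2) - h / 8) \<le> (h / 8) / (3 / 8)"
      using h by (intro divide_left_mono) auto
    then have "\<bar>t - m\<bar> < (b - a) / 2" using t h by simp
    then have "t \<in> J" using J by (auto simp: m_def abs_if field_simps subset_iff split: if_splits)
    moreover have "0 < cmod z" "cmod z < 1" "1 - cmod z < b - a" using t(3) h by (auto simp: abs_if split: if_splits)
    ultimately show "z \<in> carleson_square (cis ` J)"
      unfolding sq using t(2) by blast
  qed
  also have "\<dots> \<subseteq> unit_disc" using Q by (simp add: sets_area)
  finally have "measure area (ball c (h / 8)) = (h / 8)\<^sup>2"
    using h by (simp add: measure_area measure_lebesgue_ball)
  then show ?thesis using area.finite_measure_mono[OF sub Q] by simp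
qed

text \<open>Short arcs give r = 2 (b - a), for which r^2 / 256 is the square of (b - a) / 8. For
  long arcs the whole disc is taken, and an inner ball of radius 1 / 16 leads to the same constant
  256.\<close>

lemma carleson_square_in_disc:
  assumes "Q \<in> carleson_squares"
  obtains c r where "c \<in> unit_disc" "0 < r" "r \<le> 1" "Q \<subseteq> trunc_disc c r" "r\<^sup>2 / 256 \<le> measure area Q"
proof -
  obtain J a b where ab: "a < b" "b \<le> a + 2 * pi" and J: "{a<..<b} \<subseteq> J" "J \<subseteq> {a..b}"
    and Q: "Q = carleson_square (cis ` J)"
    using assms by (auto simp: carleson_squares_def arcs_def)
  show ?thesis
  proof (cases "b - a \<le> 1 / 2")
    case True
    then obtain c where c: "c \<in> unit_disc" "Q \<subseteq> trunc_disc c (2 * (b - a))"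
      using carleson_square_subset_disc[OF ab(1) _ J] by (auto simp: Q)
    have "((b - a) / 8)\<^sup>2 \<le> measure area Q"
      unfolding Q using True ab by (intro carleson_square_measure_ge[OF ab J]) auto
    moreover have "(2 * (b - a))\<^sup>2 / 256 = ((b - a) / 8)\<^sup>2"
      unfolding power_mult_distrib power_divide by simp
    ultimately show ?thesis using that[of c "2 * (b - a)"] c True ab by simp
  next
    case False
    have "((1 / 2) / 8)\<^sup>2 \<le> measure area Q"
      unfolding Q using False by (intro carleson_square_measure_ge[OF ab J]) auto
    moreover have "Q \<subseteq> trunc_disc 0 1"
      using carleson_square_in_sets[OF assms] by (simp add: sets_area trunc_disc_def)
    ultimately show ?thesis using that[of 0 1] by (simp add: power_divide)
  qed
qed

lemma carleson_square_measure_pos: "Q \<in> carleson_squares \<Longrightarrow> 0 < measure area Q"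
  by (erule carleson_square_in_disc) (smt (verit) divide_pos_pos zero_less_power)

text \<open>The full circle has length 2 pi > 1, so the condition on the depth is void. This largest
  square turns estimates over squares into global integrability.\<close>

lemma punctured_disc_in_carleson_squares: "unit_disc - {0} \<in> carleson_squares"
proof -
  have sq: "carleson_square (cis ` {0..2 * pi}) =
    {of_real r * cis t | r t. 0 < r \<and> r < 1 \<and> 1 - r < 2 * pi - 0 \<and> t \<in> {0..2 * pi}}"
    by (intro carleson_square_arc) auto
  have "unit_disc - {0} = carleson_square (cis ` {0..2 * pi})"
  proof (intro equalityI subsetI)
    fix z assume z: "z \<in> unit_disc - {0}"
    then have "z = of_real (cmod z) * cis (Arg2pi z)"
      using Arg2pi[of z] by (simp add: cis_conv_exp is_Arg_def)
    moreover have "Arg2pi z \<in> {0..2 * pi}" using Arg2pi[of z] by simp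
    moreover have "1 - cmod z < 2 * pi - 0" using pi_ge_two norm_ge_zero[of z] by linarith
    ultimately show "z \<in> carleson_square (cis ` {0..2 * pi})"
      using z unfolding sq by (intro CollectI exI[of _ "cmod z"] exI[of _ "Arg2pi z"]) simp
  qed (simp add: carleson_square_def)
  moreover have "cis ` {0..2 * pi} \<in> arcs"
    unfolding arcs_def by (intro CollectI exI[of _ "{0..2 * pi}"] exI[of _ 0] exI[of _ "2 * pi"]) auto
  ultimately show ?thesis by (auto simp: carleson_squares_def)
qed

lemma arc_square:
  assumes "0 < h" "h \<le> 1 / 2"
  shows "carleson_square (cis ` {a..a + h}) \<in> carleson_squares"
    and "measure area (carleson_square (cis ` {a..a + h})) \<le> 4 * h\<^sup>2"
proof -
  have "a + h \<le> a + 2 * pi" using assms pi_ge_two by linarith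
  then show *: "carleson_square (cis ` {a..a + h}) \<in> carleson_squares"
    unfolding carleson_squares_def arcs_def using assms
    by (intro imageI CollectI exI[of _ "{a..a + h}"] exI[of _ a] exI[of _ "a + h"]) auto
  obtain c where c: "c \<in> unit_disc" "carleson_square (cis ` {a..a + h}) \<subseteq> trunc_disc c (2 * h)"
    using carleson_square_subset_disc[of a "a + h" "{a..a + h}"] assms
    by (auto simp: greaterThanLessThan_subseteq_atLeastAtMost_iff)
  then have "measure area (carleson_square (cis ` {a..a + h})) \<le> measure area (trunc_disc c (2 * h))"
    by (intro area.finite_measure_mono) auto
  also have "\<dots> \<le> (2 * h)\<^sup>2"
    unfolding trunc_disc_def using c assms by (intro area_disc_bounds) auto
  finally show "measure area (carleson_square (cis ` {a..a + h})) \<le> 4 * h\<^sup>2" by (simp add: power_mult_distrib)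
qed

text \<open>The supremum in (ii) is thereby not one over the empty set, whose value would be
  0.\<close>

lemma small_carleson_square_exists:
  assumes "0 < \<delta>"
  shows "\<exists>Q\<in>carleson_squares. measure area Q < \<delta>"
proof -
  define h where "h = min (1 / 2) (\<delta> / 4)"
  have h: "0 < h" "h \<le> 1 / 2" "h \<le> \<delta> / 4" using assms by (auto simp: h_def)
  have "4 * h\<^sup>2 \<le> 4 * (1 / 2 * (\<delta> / 4))"
    unfolding power2_eq_square using h by (intro mult_left_mono mult_mono) auto
  also have "\<dots> < \<delta>" using assms by simp
  finally show ?thesis using arc_square[OF h(1,2), of 0] by force
qed

text \<open>The square has side \<open>16 * r\<close> and is centred at the argument of
  \<open>c\<close>. Since \<open>cmod c - r\<close> exceeds 1 / 8, points of the disc deviate by at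
  most \<open>8 * r\<close> in angle, and their depth is below \<open>3 * r\<close>. The bound on
  \<open>r\<close> keeps the arc length within 1 / 2, as \<open>arc_square\<close> requires.\<close>

lemma boundary_disc_in_carleson_square:
  assumes c: "c \<in> unit_disc" "1 - cmod c < 2 * r" and r: "r \<le> 1 / 32"
  shows "\<exists>Q\<in>carleson_squares. trunc_disc c r \<subseteq> Q \<and> measure area Q \<le> (32 * r)\<^sup>2"
proof -
  have r0: "0 < r" using c by simp
  have "c \<noteq> 0" using c r by auto
  define m where "m = Arg c"
  have cm: "c = of_real (cmod c) * cis m"
    using \<open>c \<noteq> 0\<close> by (simp add: m_def cis_Arg sgn_eq)
  define J where "J = {m - 8 * r..(m - 8 * r) + 16 * r}"
  have sq: "carleson_square (cis ` J) =
    {of_real r' * cis t | r' t. 0 < r' \<and> r' < 1 \<and> 1 - r' < (m - 8 * r) + 16 * r - (m - 8 * r) \<and> t \<in> J}"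
    unfolding J_def using r0 r pi_ge_two by (intro carleson_square_arc) auto
  have "trunc_disc c r \<subseteq> carleson_square (cis ` J)"
  proof
    fix z assume z: "z \<in> trunc_disc c r"
    then have "cmod (z - of_real (cmod c) * cis m) < r"
      using cm by (simp add: trunc_disc_def dist_norm norm_minus_commute)
    then obtain t where t: "\<bar>t - m\<bar> \<le> r / (cmod c - r)"
      "z = of_real (cmod z) * cis t" "\<bar>cmod z - cmod c\<bar> < r"
      using polar_near[of z "cmod c" m r] c r by auto
    have "r / (cmod c - r) \<le> r / (1 / 8)" using c r r0 by (intro divide_left_mono) auto
    then have "\<bar>t - m\<bar> \<le> 8 * r" using t by simp
    then have "t \<in> J" by (auto simp: J_def)
    moreover have "0 < cmod z" "cmod z < 1" "1 - cmod z < 16 * r"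
      using t(3) z c r by (auto simp: trunc_disc_def)
    ultimately show "z \<in> carleson_square (cis ` J)"
      unfolding sq using t(2) by (intro CollectI exI[of _ "cmod z"] exI[of _ t]) simp
  qed
  moreover have "carleson_square (cis ` J) \<in> carleson_squares"
    "measure area (carleson_square (cis ` J)) \<le> 4 * (16 * r)\<^sup>2"
    unfolding J_def using r r0 by (intro arc_square; simp)+
  moreover have "4 * (16 * r)\<^sup>2 = (32 * r)\<^sup>2" by (simp add: power_mult_distrib)
  ultimately show ?thesis by metis
qed


section \<open>Exponentials of functions in BMO and VMO\<close>

lemma nn_mean_mono:
  assumes "\<And>x. x \<in> Q \<Longrightarrow> f x \<le> g x"
  shows "nn_mean f Q \<le> nn_mean g Q"
  unfolding nn_mean_def using assms
  by (intro divide_right_mono_ennreal nn_integral_mono) (auto simp: indicator_def ennreal_leI)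

lemma nn_mean_cmult:
  assumes "f \<in> borel_measurable area" "Q \<in> sets area" "0 \<le> c"
  shows "nn_mean (\<lambda>x. c * f x) Q = ennreal c * nn_mean f Q"
  unfolding nn_mean_def using assms
  by (simp add: ennreal_mult' mult.assoc nn_integral_cmult ennreal_times_divide)

lemma nn_mean_add:
  assumes [measurable]: "f \<in> borel_measurable area" "g \<in> borel_measurable area" "Q \<in> sets area"
    and "\<And>x. 0 \<le> f x" "\<And>x. 0 \<le> g x"
  shows "nn_mean (\<lambda>x. f x + g x) Q = nn_mean f Q + nn_mean g Q"
  unfolding nn_mean_def using assms(4-)
  by (simp add: ennreal_plus distrib_right nn_integral_add add_divide_distrib_ennreal)

lemma emeasure_area_pos:
  assumes "0 < measure area Q"
  shows "emeasure area Q \<noteq> 0" "emeasure area Q < top"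
  using assms by (auto simp: area.emeasure_eq_measure ennreal_zero_less_mult_iff)

lemma nn_mean_const:
  assumes "Q \<in> sets area" "0 < measure area Q"
  shows "nn_mean (\<lambda>_. c) Q = ennreal c"
  using assms emeasure_area_pos[OF assms(2)]
  by (simp add: nn_mean_def nn_integral_cmult_indicator ennreal_times_divide[symmetric])

lemma nn_mean_exp_le:
  assumes [measurable]: "u \<in> borel_measurable area" "Q \<in> sets area"
    and K: "nn_mean (\<lambda>x. exp \<bar>u x - a\<bar>) Q \<le> ennreal K"
  shows "nn_mean (\<lambda>x. exp (u x)) Q \<le> ennreal (exp a) * ennreal K"
proof -
  have "nn_mean (\<lambda>x. exp (u x)) Q \<le> nn_mean (\<lambda>x. exp a * exp \<bar>u x - a\<bar>) Q"
    by (intro nn_mean_mono) (simp flip: exp_add)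
  also have "\<dots> = ennreal (exp a) * nn_mean (\<lambda>x. exp \<bar>u x - a\<bar>) Q" by (intro nn_mean_cmult) auto
  finally show ?thesis using K by (meson mult_left_mono order_trans zero_le)
qed

text \<open>The factors \<open>exp a\<close> and \<open>exp (- a)\<close> cancel in the product, so
  \<open>a\<close> may be any constant that the John-Nirenberg inequality supplies.\<close>

lemma nn_mean_exp_prod_le:
  assumes [measurable]: "u \<in> borel_measurable area" "Q \<in> sets area"
    and K: "nn_mean (\<lambda>x. exp \<bar>u x - a\<bar>) Q \<le> ennreal K" "0 \<le> K"
  shows "nn_mean (\<lambda>x. exp (u x)) Q * nn_mean (\<lambda>x. exp (- u x)) Q \<le> ennreal (K\<^sup>2)"
proof -
  have "\<bar>- u x - - a\<bar> = \<bar>u x - a\<bar>" for x by simp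
  then have "nn_mean (\<lambda>x. exp (- u x)) Q \<le> ennreal (exp (- a)) * ennreal K"
    using K by (intro nn_mean_exp_le) auto
  moreover have "nn_mean (\<lambda>x. exp (u x)) Q \<le> ennreal (exp a) * ennreal K"
    using K by (intro nn_mean_exp_le) auto
  ultimately have "nn_mean (\<lambda>x. exp (u x)) Q * nn_mean (\<lambda>x. exp (- u x)) Q
      \<le> (ennreal (exp a) * ennreal K) * (ennreal (exp (- a)) * ennreal K)"
    by (intro mult_mono) auto
  also have "\<dots> = ennreal ((exp a * K) * (exp (- a) * K))" using K(2) by (simp add: ennreal_mult)
  also have "(exp a * K) * (exp (- a) * K) = (exp a * exp (- a)) * (K * K)" by (simp only: mult_ac)
  also have "\<dots> = K\<^sup>2" by (simp add: power2_eq_square flip: exp_add)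
  finally show ?thesis .
qed

text \<open>This is the Cauchy-Schwarz inequality, obtained from 1 / t + t / A^2 \<ge> 2 / A for t =
  exp (u x), where \<open>A\<close> is the mean of exp u: averaging gives B + 1 / A \<ge> 2 / A. If
  one mean is infinite, so is the product, the other mean being nonzero.\<close>

lemma nn_mean_exp_prod_ge_1:
  assumes [measurable]: "u \<in> borel_measurable area" "Q \<in> sets area" and Q: "0 < measure area Q"
  shows "1 \<le> nn_mean (\<lambda>x. exp (u x)) Q * nn_mean (\<lambda>x. exp (- u x)) Q"
proof -
  have pos: "nn_mean (\<lambda>x. exp (v x)) Q \<noteq> 0" if [measurable]: "v \<in> borel_measurable area" for v
  proof
    assume "nn_mean (\<lambda>x. exp (v x)) Q = 0"
    then have "(\<integral>\<^sup>+x\<in>Q. ennreal (exp (v x)) \<partial>area) = 0"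
      by (simp add: nn_mean_def area.emeasure_eq_measure)
    then have "AE x in area. ennreal (exp (v x)) * indicator Q x = 0"
      by (subst (asm) nn_integral_0_iff_AE) auto
    then have "AE x in area. x \<notin> Q" by eventually_elim (auto simp: indicator_def split: if_splits)
    then have "Q \<in> null_sets area" by (simp add: AE_iff_null_sets)
    then show False using Q by (auto simp: null_sets_def measure_def)
  qed
  show ?thesis
  proof (cases "nn_mean (\<lambda>x. exp (u x)) Q = top \<or> nn_mean (\<lambda>x. exp (- u x)) Q = top")
    case True
    then show ?thesis using pos[of u] pos[of "\<lambda>x. - u x"] by (auto simp: ennreal_mult_top ennreal_top_mult)
  next
    case False
    then obtain A B where A: "nn_mean (\<lambda>x. exp (u x)) Q = ennreal A" "0 \<le> A"
      and B: "nn_mean (\<lambda>x. exp (- u x)) Q = ennreal B" "0 \<le> B"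
      by (metis ennreal_cases)
    have "0 < A" using A pos[of u] by (cases "A = 0") auto
    have "ennreal (2 / A) = nn_mean (\<lambda>_. 2 / A) Q" using Q by (simp add: nn_mean_const)
    also have "\<dots> \<le> nn_mean (\<lambda>x. exp (- u x) + 1 / A\<^sup>2 * exp (u x)) Q"
    proof (intro nn_mean_mono)
      fix x
      define t where "t = exp (u x)"
      have "0 < t" by (simp add: t_def)
      have "0 \<le> (t - A)\<^sup>2 / (A\<^sup>2 * t)" using \<open>0 < t\<close> by simp
      also have "\<dots> = 1 / t + 1 / A\<^sup>2 * t - 2 / A"
        using \<open>0 < t\<close> \<open>0 < A\<close> by (simp add: field_simps power2_eq_square)
      finally show "2 / A \<le> exp (- u x) + 1 / A\<^sup>2 * exp (u x)"
        by (simp add: t_def exp_minus field_simps)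
    qed
    also have "\<dots> = nn_mean (\<lambda>x. exp (- u x)) Q + nn_mean (\<lambda>x. 1 / A\<^sup>2 * exp (u x)) Q"
      by (intro nn_mean_add) auto
    also have "nn_mean (\<lambda>x. 1 / A\<^sup>2 * exp (u x)) Q = ennreal (1 / A\<^sup>2) * nn_mean (\<lambda>x. exp (u x)) Q"
      by (intro nn_mean_cmult) auto
    also have "nn_mean (\<lambda>x. exp (- u x)) Q + \<dots> = ennreal (B + 1 / A\<^sup>2 * A)"
      using A B by (simp add: ennreal_plus flip: ennreal_mult)
    finally have "2 / A \<le> B + 1 / A\<^sup>2 * A" using A B by (subst (asm) ennreal_le_iff) auto
    then have "1 \<le> A * B" using \<open>0 < A\<close> by (simp add: field_simps power2_eq_square)
    then show ?thesis using A B by (simp flip: ennreal_mult)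
  qed
qed

lemma mean_divide: "mean (\<lambda>x. f x / c) E = mean f E / c"
  by (simp add: mean_def)

lemma mean_osc_divide: "0 < c \<Longrightarrow> mean_osc (\<lambda>x. f x / c) E = mean_osc f E / c"
  by (simp add: mean_osc_def mean_divide abs_divide flip: diff_divide_distrib)

text \<open>Dividing \<open>f\<close> by \<open>\<eta>\<close> normalizes the oscillations to 1. The
  bound 5 r^2 on the surrounding disc is at most 1280 times the area of \<open>Q\<close>, and
  \<open>a\<close> is the mean of \<open>f\<close> over the doubled disc.\<close>

lemma carleson_square_exp_bound:
  assumes f: "integrable area f" and \<eta>: "0 < \<eta>"
    and osc: "\<And>E. E \<in> bmo_discs \<Longrightarrow> mean_osc f E \<le> \<eta>" and Q: "Q \<in> carleson_squares"
  shows "\<exists>a. nn_mean (\<lambda>x. exp (ln 2 / 6400 * \<bar>f x - a\<bar> / \<eta>)) Q \<le> 1280"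
proof -
  obtain c r where c: "c \<in> unit_disc" and r: "0 < r" "r \<le> 1" and sub: "Q \<subseteq> trunc_disc c r"
    and ge: "r\<^sup>2 / 256 \<le> measure area Q"
    using carleson_square_in_disc[OF Q] .
  define g where "g x = f x / \<eta>" for x
  have g: "integrable area g" using f unfolding g_def by auto
  have g_osc: "mean_osc g E \<le> 1" if "E \<in> bmo_discs" for E
    unfolding g_def using osc[OF that] \<eta> by (simp add: mean_osc_divide)
  define a where "a = mean f (trunc_disc c (2 * r))"
  have eq: "2 powr (\<bar>g x - mean g (trunc_disc c (2 * r))\<bar> / 6400) = exp (ln 2 / 6400 * \<bar>f x - a\<bar> / \<eta>)" for x
  proof -
    have "mean g (trunc_disc c (2 * r)) = a / \<eta>" unfolding g_def a_def by (rule mean_divide)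
    then have "\<bar>g x - mean g (trunc_disc c (2 * r))\<bar> = \<bar>f x - a\<bar> / \<eta>"
      using \<eta> by (simp add: g_def flip: diff_divide_distrib)
    then show ?thesis by (simp add: powr_def mult_ac)
  qed
  have "(\<integral>\<^sup>+x\<in>Q. ennreal (exp (ln 2 / 6400 * \<bar>f x - a\<bar> / \<eta>)) \<partial>area) \<le>
    (\<integral>\<^sup>+x\<in>trunc_disc c r. ennreal (exp (ln 2 / 6400 * \<bar>f x - a\<bar> / \<eta>)) \<partial>area)"
    using sub by (intro nn_integral_mono) (auto simp: indicator_def)
  also have "\<dots> \<le> ennreal (5 * r\<^sup>2)"
    using john_nirenberg_powr[OF g g_osc c r] unfolding eq by simp
  also have "\<dots> \<le> ennreal (1280 * measure area Q)" using ge by (intro ennreal_leI) simp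
  also have "\<dots> = 1280 * emeasure area Q" by (simp add: ennreal_mult area.emeasure_eq_measure)
  finally have "nn_mean (\<lambda>x. exp (ln 2 / 6400 * \<bar>f x - a\<bar> / \<eta>)) Q \<le> 1280 * emeasure area Q / emeasure area Q"
    unfolding nn_mean_def by (intro divide_right_mono_ennreal)
  also have "\<dots> = 1280"
    using emeasure_area_pos[OF carleson_square_measure_pos[OF Q]]
    by (simp add: ennreal_times_divide[symmetric])
  finally show ?thesis ..
qed

lemma mean_osc_nonneg: "0 \<le> mean_osc f E"
  unfolding mean_osc_def mean_def set_lebesgue_integral_def
  by (intro divide_nonneg_nonneg integral_nonneg_AE) auto

lemma mean_osc_le_bmo_norm: "f \<in> BMO \<Longrightarrow> E \<in> bmo_discs \<Longrightarrow> mean_osc f E \<le> bmo_norm f"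
  unfolding BMO_def bmo_norm_def by (auto intro!: cSUP_upper)

lemma bmo_norm_nonneg:
  assumes "f \<in> BMO"
  shows "0 \<le> bmo_norm f"
proof -
  have "trunc_disc 0 1 \<in> bmo_discs" by (intro trunc_disc_in_bmo_discs) auto
  then show ?thesis using mean_osc_le_bmo_norm[OF assms] mean_osc_nonneg order_trans by blast
qed

lemma origin_null: "{0} \<in> null_sets area"
  by (simp add: null_sets_def sets_area emeasure_area)

text \<open>Every Carleson square omits the origin, so estimates over squares reach the punctured
  disc at best; the missing point is null.\<close>

lemma integrable_area_punctured:
  fixes f :: "complex \<Rightarrow> real"
  assumes "f \<in> borel_measurable area" "set_integrable area (unit_disc - {0}) f"
  shows "integrable area f"
proof -
  have "AE x in area. x \<in> unit_disc - {0}"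
    using AE_not_in[OF origin_null] AE_space by eventually_elim auto
  then have "AE x in area. indicator (unit_disc - {0}) x *\<^sub>R f x = f x"
    by eventually_elim auto
  moreover have "(\<lambda>x. indicator (unit_disc - {0}) x *\<^sub>R f x) \<in> borel_measurable area"
    using assms(2) by (simp add: set_integrable_def)
  ultimately show ?thesis
    using assms integrable_cong_AE[of "\<lambda>x. indicator (unit_disc - {0}) x *\<^sub>R f x" area f]
    by (simp add: set_integrable_def)
qed

lemma exp_BMO_in_B2:
  assumes f: "f \<in> BMO" "bmo_norm f \<noteq> 0"
  shows "(\<lambda>z. exp (ln 2 / 6400 * f z / bmo_norm f)) \<in> B2"
    and "B2_const (\<lambda>z. exp (ln 2 / 6400 * f z / bmo_norm f)) \<le> 1280"
proof -
  define n where "n = bmo_norm f"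
  have n: "0 < n" using bmo_norm_nonneg[OF f(1)] f(2) by (simp add: n_def)
  define u where "u z = ln 2 / 6400 * f z / n" for z
  have fi: "integrable area f" using f by (simp add: BMO_def)
  then have [measurable]: "f \<in> borel_measurable area" by auto
  have um[measurable]: "u \<in> borel_measurable area" unfolding u_def by measurable
  have bound: "\<exists>a. nn_mean (\<lambda>x. exp \<bar>u x - a\<bar>) Q \<le> ennreal 1280" if Q: "Q \<in> carleson_squares" for Q
  proof -
    obtain a where a: "nn_mean (\<lambda>x. exp (ln 2 / 6400 * \<bar>f x - a\<bar> / n)) Q \<le> 1280"
      using carleson_square_exp_bound[OF fi n _ Q] mean_osc_le_bmo_norm[OF f(1)] n_def by blast
    have "\<bar>u x - ln 2 / 6400 * a / n\<bar> = ln 2 / 6400 * \<bar>f x - a\<bar> / n" for x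
    proof -
      have "u x - ln 2 / 6400 * a / n = ln 2 / 6400 * (f x - a) / n" 
        using n by (simp add: u_def right_diff_distrib diff_divide_distrib)
      then show ?thesis using n by (simp add: abs_mult abs_divide)
    qed
    then show ?thesis using a by (intro exI[of _ "ln 2 / 6400 * a / n"]) simp
  qed
  have sup: "B2_sup (\<lambda>z. exp (u z)) \<le> ennreal (1280\<^sup>2)"
    unfolding B2_sup_def
  proof (rule SUP_least)
    fix Q assume Q: "Q \<in> carleson_squares"
    then obtain a where "nn_mean (\<lambda>x. exp \<bar>u x - a\<bar>) Q \<le> ennreal 1280" using bound by blast
    then have "nn_mean (\<lambda>x. exp (u x)) Q * nn_mean (\<lambda>x. exp (- u x)) Q \<le> ennreal (1280\<^sup>2)"
      using carleson_square_in_sets[OF Q] by (intro nn_mean_exp_prod_le) auto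
    then show "nn_mean (\<lambda>z. exp (u z)) Q * nn_mean (\<lambda>z. 1 / exp (u z)) Q \<le> ennreal (1280\<^sup>2)"
      by (simp add: exp_minus inverse_eq_divide)
  qed
  \<comment> \<open>A weight must be integrable over the whole disc. The exponential bound for the
    largest Carleson square provides this.\<close>
  have "integrable area (\<lambda>z. exp (u z))"
  proof (rule integrable_area_punctured)
    let ?Q = "unit_disc - {0}"
    note Q = punctured_disc_in_carleson_squares
    obtain a where "nn_mean (\<lambda>x. exp \<bar>u x - a\<bar>) ?Q \<le> ennreal 1280" using bound[OF Q] by blast
    then have "nn_mean (\<lambda>x. exp (u x)) ?Q \<le> ennreal (exp a) * ennreal 1280"
      using carleson_square_in_sets[OF Q] by (intro nn_mean_exp_le) auto
    also have "\<dots> < top" by (simp add: ennreal_mult_less_top)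
    finally have "(\<integral>\<^sup>+x\<in>?Q. ennreal (exp (u x)) \<partial>area) < top"
      using emeasure_area_pos[OF carleson_square_measure_pos[OF Q]]
      by (cases "(\<integral>\<^sup>+x\<in>?Q. ennreal (exp (u x)) \<partial>area) = top")
        (auto simp: nn_mean_def ennreal_top_divide less_top)
    moreover have "(\<integral>\<^sup>+x. ennreal (norm (indicator ?Q x *\<^sub>R exp (u x))) \<partial>area) = (\<integral>\<^sup>+x\<in>?Q. ennreal (exp (u x)) \<partial>area)"
      by (intro nn_integral_cong) (auto simp: indicator_def)
    ultimately show "set_integrable area ?Q (\<lambda>z. exp (u z))"
      unfolding set_integrable_def integrable_iff_bounded
      using carleson_square_in_sets[OF Q] by auto
  qed simp
  then have "weight (\<lambda>z. exp (u z))" by (simp add: weight_def)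
  moreover have "B2_sup (\<lambda>z. exp (u z)) < \<infinity>" using sup by (auto simp: less_top[symmetric] top_unique intro: le_less_trans)
  ultimately have "(\<lambda>z. exp (u z)) \<in> B2" by (simp add: B2_def)
  moreover have "B2_const (\<lambda>z. exp (u z)) \<le> sqrt (1280\<^sup>2)"
    unfolding B2_const_def using sup by (intro real_sqrt_le_mono enn2real_leI) auto
  ultimately show "(\<lambda>z. exp (ln 2 / 6400 * f z / bmo_norm f)) \<in> B2"
    "B2_const (\<lambda>z. exp (ln 2 / 6400 * f z / bmo_norm f)) \<le> 1280"
    by (simp_all add: u_def n_def)
qed

section \<open>Perturbation of the mean and of the function; the limit for VMO\<close>

text \<open>By the triangle inequality, measuring from an arbitrary constant \<open>a\<close>
  instead of the mean costs at most a factor 2. The BMO estimate for logarithms relies on this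
  freedom.\<close>

lemma mean_osc_le:
  assumes f: "integrable area f" and E: "E \<in> sets area" "0 < measure area E"
    and le: "(LINT x:E|area. \<bar>f x - a\<bar>) \<le> b * measure area E"
  shows "mean_osc f E \<le> 2 * b"
proof -
  have d: "\<bar>mean f E - a\<bar> \<le> b" by (rule abs_mean_diff_le[OF f E le])
  have int: "set_integrable area E (\<lambda>x. \<bar>f x - k\<bar>)" for k using f E by (intro set_integrable_area) auto
  have intb: "set_integrable area E (\<lambda>_. b)" using E by (intro set_integrable_area) auto
  have "(LINT x:E|area. \<bar>f x - mean f E\<bar>) \<le> (LINT x:E|area. \<bar>f x - a\<bar> + b)"
    using d int intb by (intro set_integral_mono set_integral_add) auto
  also have "\<dots> = (LINT x:E|area. \<bar>f x - a\<bar>) + b * measure area E"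
    using int intb E Int_absorb2[of E unit_disc]
    by (simp add: set_integral_add sets_area set_lebesgue_integral_def[of _ _ "\<lambda>_. b"])
  also have "\<dots> \<le> 2 * b * measure area E" using le by simp
  finally show ?thesis using E by (simp add: mean_osc_def mean_def pos_divide_le_eq)
qed

lemma mean_osc_diff_le:
  assumes f: "integrable area f" and p: "integrable area p" "\<And>x. x \<in> unit_disc \<Longrightarrow> \<bar>p x\<bar> \<le> B"
    and E: "E \<in> sets area" "0 < measure area E"
  shows "mean_osc (\<lambda>x. f x - p x) E \<le> 2 * (mean_osc f E + B)"
proof (rule mean_osc_le[OF _ E])
  show "integrable area (\<lambda>x. f x - p x)" using f p by auto
  have int: "set_integrable area E (\<lambda>x. \<bar>f x - mean f E\<bar>)" "set_integrable area E (\<lambda>_. B)"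
    "set_integrable area E (\<lambda>x. \<bar>f x - p x - mean f E\<bar>)"
    using f p E by (auto intro!: set_integrable_area)
  have "(LINT x:E|area. \<bar>f x - p x - mean f E\<bar>) \<le> (LINT x:E|area. \<bar>f x - mean f E\<bar> + B)"
  proof (intro set_integral_mono set_integral_add int)
    fix x assume "x \<in> E"
    then have "\<bar>p x\<bar> \<le> B" using p(2)[of x] E by (auto simp: sets_area)
    then show "\<bar>f x - p x - mean f E\<bar> \<le> \<bar>f x - mean f E\<bar> + B" by linarith
  qed
  also have "\<dots> = (LINT x:E|area. \<bar>f x - mean f E\<bar>) + B * measure area E"
    using int E Int_absorb2[of E unit_disc]
    by (simp add: set_integral_add sets_area set_lebesgue_integral_def[of _ _ "\<lambda>_. B"])
  also have "(LINT x:E|area. \<bar>f x - mean f E\<bar>) = mean_osc f E * measure area E"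
    using E by (simp add: mean_osc_def mean_def)
  finally show "(LINT x:E|area. \<bar>f x - p x - mean f E\<bar>) \<le> (mean_osc f E + B) * measure area E"
    by (simp add: distrib_right)
qed

lemma bmo_discsE:
  assumes "E \<in> bmo_discs"
  obtains c r where "c \<in> unit_disc" "0 < r" "E = trunc_disc c r"
  using assms by (auto simp: bmo_discs_def trunc_disc_def)

text \<open>The real supremum \<open>bmo_norm\<close> bounds the individual oscillations only if
  they are bounded above. Membership of \<open>f - p\<close> in \<open>BMO\<close> is what makes the
  smallness of its norm in \<open>VMO\<close> usable.\<close>

lemma BMO_diff_polynomial:
  assumes f: "f \<in> BMO" and p: "real_polynomial_function p"
  shows "(\<lambda>x. f x - p x) \<in> BMO"
proof -
  have fi: "integrable area f" using f by (simp add: BMO_def)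
  have cont: "continuous_on UNIV p"
    using p by (simp add: continuous_on_eq_continuous_at continuous_real_polymonial_function)
  then have [measurable]: "p \<in> borel_measurable borel" by (rule borel_measurable_continuous_onI)
  have "compact (p ` cball 0 1)"
    using cont by (intro compact_continuous_image) (auto intro: continuous_on_subset)
  then obtain B where B: "\<And>x. x \<in> cball 0 1 \<Longrightarrow> \<bar>p x\<bar> \<le> B"
    using compact_imp_bounded[of "p ` cball 0 1"] unfolding bounded_iff by fastforce
  have "p \<in> borel_measurable (lebesgue_on unit_disc)"
    by (intro measurable_restrict_space1 measurable_completion) simp
  then have pm: "p \<in> borel_measurable area" by (simp add: area_def)
  have pi: "integrable area p"
    using pm B by (intro area.integrable_const_bound[of _ B]) auto
  have "bdd_above (mean_osc (\<lambda>x. f x - p x) ` bmo_discs)"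
  proof (rule bdd_aboveI2)
    fix E assume E: "E \<in> bmo_discs"
    then obtain c r where "c \<in> unit_disc" "0 < r" "E = trunc_disc c r" by (rule bmo_discsE)
    then have "mean_osc (\<lambda>x. f x - p x) E \<le> 2 * (mean_osc f E + B)"
      using B by (intro mean_osc_diff_le fi pi) (auto simp: measure_trunc_disc_pos)
    also have "\<dots> \<le> 2 * (bmo_norm f + B)" using mean_osc_le_bmo_norm[OF f E] by simp
    finally show "mean_osc (\<lambda>x. f x - p x) E \<le> 2 * (bmo_norm f + B)" .
  qed
  then show ?thesis using fi pi by (simp add: BMO_def)
qed


text \<open>Convexity of the exponential function turns the uniform bound of
  \<open>carleson_square_exp_bound\<close> into one that is close to \<open>1\<close> when the oscillation is small.\<close>

lemma nn_mean_exp_close_1: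
  assumes f: "integrable area f" and \<theta>: "0 < \<theta>" "\<theta> \<le> 1"
    and osc: "\<And>E. E \<in> bmo_discs \<Longrightarrow> mean_osc f E \<le> ln 2 / 6400 * \<theta>" and Q: "Q \<in> carleson_squares"
  shows "\<exists>a. nn_mean (\<lambda>x. exp \<bar>f x - a\<bar>) Q \<le> ennreal (1 + 1280 * \<theta>)"
proof -
  define s :: real where "s = ln 2 / 6400"
  have s: "0 < s" by (simp add: s_def)
  have [measurable]: "f \<in> borel_measurable area" "Q \<in> sets area"
    using f carleson_square_in_sets[OF Q] by auto
  \<comment> \<open>The choice of \<open>s * \<theta>\<close> for the oscillation bound turns the
    exponent into |f - a| / \<open>\<theta>\<close>.\<close>
  obtain a where a: "nn_mean (\<lambda>x. exp (s * \<bar>f x - a\<bar> / (s * \<theta>))) Q \<le> 1280"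
    using carleson_square_exp_bound[OF f _ osc Q] s \<theta> by (auto simp: s_def)
  have "nn_mean (\<lambda>x. exp \<bar>f x - a\<bar>) Q \<le> nn_mean (\<lambda>x. 1 + \<theta> * exp (s * \<bar>f x - a\<bar> / (s * \<theta>))) Q"
  proof (rule nn_mean_mono)
    fix x
    define t where "t = \<bar>f x - a\<bar> / \<theta>"
    have "exp ((1 - \<theta>) *\<^sub>R 0 + \<theta> *\<^sub>R t) \<le> (1 - \<theta>) * exp 0 + \<theta> * exp t"
      using \<theta> by (intro convex_onD[OF exp_convex]) auto
    also have "\<dots> \<le> 1 + \<theta> * exp t" using \<theta> by simp
    finally show "exp \<bar>f x - a\<bar> \<le> 1 + \<theta> * exp (s * \<bar>f x - a\<bar> / (s * \<theta>))"
      using s \<theta> by (simp add: t_def)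
  qed
  also have "\<dots> = nn_mean (\<lambda>_. 1) Q + nn_mean (\<lambda>x. \<theta> * exp (s * \<bar>f x - a\<bar> / (s * \<theta>))) Q"
    using \<theta> by (intro nn_mean_add) auto
  also have "nn_mean (\<lambda>x. \<theta> * exp (s * \<bar>f x - a\<bar> / (s * \<theta>))) Q =
      ennreal \<theta> * nn_mean (\<lambda>x. exp (s * \<bar>f x - a\<bar> / (s * \<theta>))) Q"
    using \<theta> by (intro nn_mean_cmult) auto
  also have "nn_mean (\<lambda>_. 1) Q + \<dots> \<le> 1 + ennreal \<theta> * 1280"
    using a carleson_square_measure_pos[OF Q] by (intro add_mono mult_left_mono) (auto simp: nn_mean_const)
  also have "\<dots> = ennreal (1 + 1280 * \<theta>)"
    using \<theta> by (simp add: ennreal_plus ennreal_mult mult.commute)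
  finally show ?thesis ..
qed

lemma VMO_exp_prod_le:
  assumes f: "f \<in> VMO" and x: "0 < x" "x \<le> 1"
  shows "\<exists>\<delta>>0. \<forall>Q\<in>carleson_squares. measure area Q < \<delta> \<longrightarrow>
    nn_mean (\<lambda>z. exp (f z)) Q * nn_mean (\<lambda>z. exp (- f z)) Q \<le> ennreal ((exp x * (1 + 1280 * x))\<^sup>2)"
proof -
  have fB: "f \<in> BMO" using f by (simp add: VMO_def)
  then have [measurable]: "f \<in> borel_measurable area" by (auto simp: BMO_def)
  have "0 < ln 2 / 6400 * x" using x by simp
  then obtain p where p: "real_polynomial_function p"
    and small: "bmo_norm (\<lambda>z. f z - p z) < ln 2 / 6400 * x"
    using f unfolding VMO_def by blast
  define g where "g z = f z - p z" for z
  have g: "g \<in> BMO" unfolding g_def by (rule BMO_diff_polynomial[OF fB p])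
  have g_osc: "mean_osc g E \<le> ln 2 / 6400 * x" if "E \<in> bmo_discs" for E
    using mean_osc_le_bmo_norm[OF g that] small unfolding g_def by linarith
  have gi: "integrable area g" using g by (simp add: BMO_def)
  then have [measurable]: "g \<in> borel_measurable area" by auto
  have "uniformly_continuous_on (cball 0 1) p"
    using p by (intro compact_uniformly_continuous continuous_at_imp_continuous_on)
      (auto simp: continuous_real_polymonial_function)
  then obtain d where d: "0 < d"
    "\<And>y z. y \<in> cball 0 1 \<Longrightarrow> z \<in> cball 0 1 \<Longrightarrow> dist z y < d \<Longrightarrow> dist (p z) (p y) < x"
    unfolding uniformly_continuous_on_def using x by metis
  show ?thesis
  \<comment> \<open>A square of area below d^2 / 256 lies in a disc of radius less than
    \<open>d\<close>, on which \<open>p\<close> differs from \<open>p c\<close> by less than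
    \<open>x\<close>. Deviations of \<open>f\<close> are then measured from
    \<open>p c + a\<close>.\<close>
  proof (intro exI[of _ "d\<^sup>2 / 256"] conjI ballI impI)
    show "0 < d\<^sup>2 / 256" using d by simp
    fix Q assume Q: "Q \<in> carleson_squares" and lt: "measure area Q < d\<^sup>2 / 256"
    have [measurable]: "Q \<in> sets area" by (rule carleson_square_in_sets[OF Q])
    obtain c r where c: "c \<in> unit_disc" and r: "0 < r" "r \<le> 1" and sub: "Q \<subseteq> trunc_disc c r"
      and ge: "r\<^sup>2 / 256 \<le> measure area Q"
      using carleson_square_in_disc[OF Q] .
    have "r\<^sup>2 < d\<^sup>2" using ge lt by simp
    then have "r < d" using d power2_less_imp_less[of r d] by simp
    obtain a where a: "nn_mean (\<lambda>z. exp \<bar>g z - a\<bar>) Q \<le> ennreal (1 + 1280 * x)"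
      using nn_mean_exp_close_1[OF gi x g_osc Q] by blast
    have "nn_mean (\<lambda>z. exp \<bar>f z - (p c + a)\<bar>) Q \<le> nn_mean (\<lambda>z. exp x * exp \<bar>g z - a\<bar>) Q"
    proof (rule nn_mean_mono)
      fix z assume "z \<in> Q"
      then have "z \<in> trunc_disc c r" using sub by blast
      then have "dist (p z) (p c) < x"
        using c \<open>r < d\<close> by (intro d) (auto simp: trunc_disc_def dist_commute)
      then have "\<bar>f z - (p c + a)\<bar> \<le> x + \<bar>g z - a\<bar>" by (simp add: g_def dist_real_def)
      then show "exp \<bar>f z - (p c + a)\<bar> \<le> exp x * exp \<bar>g z - a\<bar>" by (simp flip: exp_add)
    qed
    also have "\<dots> = ennreal (exp x) * nn_mean (\<lambda>z. exp \<bar>g z - a\<bar>) Q" by (intro nn_mean_cmult) auto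
    also have "\<dots> \<le> ennreal (exp x) * ennreal (1 + 1280 * x)" using a by (intro mult_left_mono) auto
    also have "\<dots> = ennreal (exp x * (1 + 1280 * x))" using x by (simp add: ennreal_mult)
    finally show "nn_mean (\<lambda>z. exp (f z)) Q * nn_mean (\<lambda>z. exp (- f z)) Q \<le> ennreal ((exp x * (1 + 1280 * x))\<^sup>2)"
      using x by (intro nn_mean_exp_prod_le) auto
  qed
qed

text \<open>The lower bound 1 holds for every square, small or not. For the upper one, the bound for
  parameter \<open>x\<close> tends to 1 as \<open>x\<close> tends to 0, and \<open>x\<close> is
  fixed before \<open>\<delta>\<close>.\<close>

lemma VMO_exp_prod_tendsto:
  assumes f: "f \<in> VMO"
  shows "((\<lambda>\<delta>::real. SUP Q\<in>{Q \<in> carleson_squares. measure area Q < \<delta>}.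
    nn_mean (\<lambda>z. exp (f z)) Q * nn_mean (\<lambda>z. exp (- f z)) Q) \<longlongrightarrow> 1) (at_right 0)"
proof (rule order_tendstoI)
  have [measurable]: "f \<in> borel_measurable area" using f by (auto simp: VMO_def BMO_def)
  let ?P = "\<lambda>Q. nn_mean (\<lambda>z. exp (f z)) Q * nn_mean (\<lambda>z. exp (- f z)) Q"
  let ?F = "\<lambda>\<delta>::real. SUP Q\<in>{Q \<in> carleson_squares. measure area Q < \<delta>}. ?P Q"
  {
    fix a :: ennreal assume "a < 1"
    have "a < ?F \<delta>" if "0 < \<delta>" for \<delta>
    proof -
      obtain Q where Q: "Q \<in> carleson_squares" "measure area Q < \<delta>"
        using small_carleson_square_exists[OF \<open>0 < \<delta>\<close>] by blast
      note \<open>a < 1\<close>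
      also have "1 \<le> ?P Q"
        using carleson_square_in_sets[OF Q(1)] carleson_square_measure_pos[OF Q(1)]
        by (intro nn_mean_exp_prod_ge_1) auto
      also have "\<dots> \<le> ?F \<delta>" using Q by (intro SUP_upper) auto
      finally show ?thesis .
    qed
    then show "\<forall>\<^sub>F \<delta> in at_right 0. a < ?F \<delta>" by (auto simp: eventually_at_right_field intro: exI[of _ 1])
  }
  {
    fix a :: ennreal assume "1 < a"
    have "((\<lambda>x::real. (exp x * (1 + 1280 * x))\<^sup>2) \<longlongrightarrow> (exp 0 * (1 + 1280 * 0))\<^sup>2) (at_right 0)"
      by (intro tendsto_intros)
    then have "((\<lambda>x::real. ennreal ((exp x * (1 + 1280 * x))\<^sup>2)) \<longlongrightarrow> ennreal 1) (at_right 0)"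
      by (intro tendsto_ennrealI) simp
    then have "\<forall>\<^sub>F x::real in at_right 0. ennreal ((exp x * (1 + 1280 * x))\<^sup>2) < a"
      using \<open>1 < a\<close> by (intro order_tendstoD) auto
    moreover have "\<forall>\<^sub>F x::real in at_right 0. 0 < x \<and> x \<le> 1"
      by (auto simp: eventually_at_right_field intro: exI[of _ 1])
    ultimately have "\<forall>\<^sub>F x::real in at_right 0. ennreal ((exp x * (1 + 1280 * x))\<^sup>2) < a \<and> 0 < x \<and> x \<le> 1"
      by eventually_elim auto
    then obtain x :: real where x: "ennreal ((exp x * (1 + 1280 * x))\<^sup>2) < a" "0 < x" "x \<le> 1"
      by (auto dest!: eventually_happens)
    obtain \<delta> where \<delta>: "0 < \<delta>" "\<And>Q. Q \<in> carleson_squares \<Longrightarrow> measure area Q < \<delta> \<Longrightarrow>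
      ?P Q \<le> ennreal ((exp x * (1 + 1280 * x))\<^sup>2)"
      using VMO_exp_prod_le[OF f x(2,3)] by blast
    have "?F \<delta>' < a" if "\<delta>' < \<delta>" for \<delta>'
    proof -
      have "?F \<delta>' \<le> ennreal ((exp x * (1 + 1280 * x))\<^sup>2)" using that by (intro SUP_least \<delta>) auto
      then show ?thesis using x by simp
    qed
    then show "\<forall>\<^sub>F \<delta> in at_right 0. ?F \<delta> < a" using \<open>0 < \<delta>\<close>
      by (auto simp: eventually_at_right_field intro: exI[of _ \<delta>])
  }
qed

section \<open>Logarithms of weights\<close>

text \<open>This replaces extended means by Lebesgue integrals. The mean of \<open>w\<close> over
  \<open>Q\<close> is positive, so an infinite mean of \<open>1 / w\<close> would make the product
  infinite.\<close>

lemma B2_means: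
  assumes w: "w \<in> B2" and Q: "Q \<in> carleson_squares"
  shows "set_integrable area Q w" "set_integrable area Q (\<lambda>x. 1 / w x)"
    and "mean w Q * mean (\<lambda>x. 1 / w x) Q \<le> (B2_const w)\<^sup>2"
proof -
  have wi: "integrable area w" and wpos: "\<And>x. x \<in> unit_disc \<Longrightarrow> 0 < w x"
    using w by (auto simp: B2_def weight_def)
  then have [measurable]: "w \<in> borel_measurable area" by auto
  have Qs[measurable]: "Q \<in> sets area" by (rule carleson_square_in_sets[OF Q])
  then have QD: "Q \<subseteq> unit_disc" by (simp add: sets_area)
  have m: "0 < measure area Q" by (rule carleson_square_measure_pos[OF Q])
  have nn: "(\<integral>\<^sup>+x. ennreal (norm (indicator Q x *\<^sub>R v x)) \<partial>area) = (\<integral>\<^sup>+x\<in>Q. ennreal (v x) \<partial>area)"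
    if "\<And>x. x \<in> Q \<Longrightarrow> 0 < v x" for v :: "complex \<Rightarrow> real"
    using that by (intro nn_integral_cong) (auto simp: indicator_def less_imp_le)
  have nn_mean_eq: "nn_mean v Q = ennreal (mean v Q)"
    if v: "set_integrable area Q v" "\<And>x. x \<in> Q \<Longrightarrow> 0 < v x" for v
  proof -
    have "(\<integral>\<^sup>+x\<in>Q. ennreal (v x) \<partial>area) = (\<integral>\<^sup>+x. ennreal (indicator Q x *\<^sub>R v x) \<partial>area)"
      by (intro nn_integral_cong) (auto simp: indicator_def)
    also have "\<dots> = ennreal (LINT x:Q|area. v x)"
      unfolding set_lebesgue_integral_def using v(1) v(2)[THEN less_imp_le]
      by (intro nn_integral_eq_integral AE_I2) (auto simp: set_integrable_def indicator_def)
    finally have "(\<integral>\<^sup>+x\<in>Q. ennreal (v x) \<partial>area) = ennreal (LINT x:Q|area. v x)" .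
    moreover have "0 \<le> (LINT x:Q|area. v x)"
      unfolding set_lebesgue_integral_def using v(2)
      by (intro integral_nonneg_AE) (auto simp: indicator_def less_imp_le)
    ultimately show ?thesis
      using m by (simp add: nn_mean_def mean_def area.emeasure_eq_measure divide_ennreal)
  qed
  show wQ: "set_integrable area Q w" using wi by (intro set_integrable_area) auto
  have winv: "0 < 1 / w x" if "x \<in> Q" for x using that QD wpos by auto
  have le: "nn_mean w Q * nn_mean (\<lambda>z. 1 / w z) Q \<le> B2_sup w"
    unfolding B2_sup_def using Q by (intro SUP_upper)
  have fin: "B2_sup w < top" using w by (simp add: B2_def)
  have "0 < (LINT x:Q|area. w x)"
  proof -
    have "(LINT x:Q|area. w x) \<noteq> 0"
    proof
      assume "(LINT x:Q|area. w x) = 0"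
      moreover have "AE x in area. 0 \<le> indicator Q x *\<^sub>R w x"
        using wpos QD by (intro AE_I2) (auto simp: indicator_def less_imp_le)
      ultimately have "AE x in area. indicator Q x *\<^sub>R w x = 0"
        using wQ unfolding set_lebesgue_integral_def set_integrable_def
        by (subst (asm) integral_nonneg_eq_0_iff_AE) auto
      then have "AE x in area. x \<notin> Q"
        by eventually_elim (use wpos QD in \<open>force simp: indicator_def\<close>)
      then have "Q \<in> null_sets area" by (simp add: AE_iff_null_sets)
      then show False using m by (auto simp: null_sets_def measure_def)
    qed
    moreover have "0 \<le> (LINT x:Q|area. w x)"
      unfolding set_lebesgue_integral_def using wpos QD
      by (intro integral_nonneg_AE AE_I2) (auto simp: indicator_def less_imp_le)
    ultimately show ?thesis by simp
  qed
  then have mw: "0 < mean w Q" using m by (simp add: mean_def)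
  have w_eq: "nn_mean w Q = ennreal (mean w Q)" using QD wpos by (intro nn_mean_eq wQ) auto
  have "nn_mean (\<lambda>z. 1 / w z) Q \<noteq> top"
  proof
    assume "nn_mean (\<lambda>z. 1 / w z) Q = top"
    then have "nn_mean w Q * nn_mean (\<lambda>z. 1 / w z) Q = top" using mw by (simp add: w_eq ennreal_mult_top)
    then show False using le fin by (simp add: top_unique)
  qed
  then have "(\<integral>\<^sup>+x\<in>Q. ennreal (1 / w x) \<partial>area) < \<infinity>"
    using emeasure_area_pos[OF m] by (auto simp: nn_mean_def ennreal_top_divide less_top[symmetric])
  moreover have "(\<integral>\<^sup>+x. ennreal (norm (indicator Q x *\<^sub>R (1 / w x))) \<partial>area) = (\<integral>\<^sup>+x\<in>Q. ennreal (1 / w x) \<partial>area)"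
    using winv by (rule nn)
  moreover have "(\<lambda>x. indicator Q x *\<^sub>R (1 / w x)) \<in> borel_measurable area" by measurable
  ultimately show wQ': "set_integrable area Q (\<lambda>x. 1 / w x)"
    by (simp only: set_integrable_def integrable_iff_bounded simp_thms)
  have w_eq': "nn_mean (\<lambda>x. 1 / w x) Q = ennreal (mean (\<lambda>x. 1 / w x) Q)"
    using winv by (intro nn_mean_eq wQ') auto
  have "ennreal (mean w Q * mean (\<lambda>x. 1 / w x) Q) \<le> B2_sup w"
    using le mw by (simp add: w_eq w_eq' ennreal_mult')
  also have "B2_sup w = ennreal (enn2real (B2_sup w))" using fin by simp
  also have "\<dots> = ennreal ((B2_const w)\<^sup>2)" by (simp add: B2_const_def)
  finally show "mean w Q * mean (\<lambda>x. 1 / w x) Q \<le> (B2_const w)\<^sup>2"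
    by (subst (asm) ennreal_le_iff) auto
qed

text \<open>Jensen's inequality, by integrating the tangent line estimate exp s \<ge> 1 + s at s =
  ln (v x) - L.\<close>

lemma exp_mean_ln_le:
  assumes v: "set_integrable area Q v" "set_integrable area Q (\<lambda>x. ln (v x))"
    and pos: "\<And>x. x \<in> Q \<Longrightarrow> 0 < v x" and Q: "Q \<in> sets area" "0 < measure area Q"
  shows "exp (mean (\<lambda>x. ln (v x)) Q) \<le> mean v Q"
proof -
  define L where "L = mean (\<lambda>x. ln (v x)) Q"
  have c: "set_integrable area Q (\<lambda>_. k)" for k :: real using Q by (intro set_integrable_area) auto
  have I: "(LINT x:Q|area. k) = k * measure area Q" for k :: real
    using Q Int_absorb2[of Q unit_disc] by (simp add: sets_area set_lebesgue_integral_def)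
  have i: "set_integrable area Q (\<lambda>x. ln (v x) + (1 - L))" by (intro set_integral_add v c)
  have "(LINT x:Q|area. exp L * (ln (v x) + (1 - L))) \<le> (LINT x:Q|area. v x)"
  proof (intro set_integral_mono set_integrable_mult_right i v)
    fix x assume "x \<in> Q"
    have "ln (v x) + (1 - L) \<le> exp (ln (v x) - L)" using exp_ge_add_one_self[of "ln (v x) - L"] by linarith
    then have "exp L * (ln (v x) + (1 - L)) \<le> exp L * exp (ln (v x) - L)" by simp
    also have "\<dots> = v x" using pos[OF \<open>x \<in> Q\<close>] by (simp flip: exp_add)
    finally show "exp L * (ln (v x) + (1 - L)) \<le> v x" .
  qed
  also have "(LINT x:Q|area. exp L * (ln (v x) + (1 - L))) = exp L * ((LINT x:Q|area. ln (v x)) + (1 - L) * measure area Q)"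
    using v c by (simp add: set_integral_mult_right set_integral_add I)
  also have "(LINT x:Q|area. ln (v x)) = L * measure area Q" using Q by (simp add: L_def mean_def)
  finally have "exp L \<le> mean v Q" using Q by (simp add: mean_def pos_le_divide_eq algebra_simps)
  then show ?thesis by (simp only: L_def)
qed

text \<open>Jensen applied to \<open>1 / w\<close> gives exp (-L) \<le> mean of
  \<open>1 / w\<close>; multiplied by the mean of \<open>w\<close> this is at most the square of
  \<open>B2_const w\<close>. The other moment follows with the roles of \<open>w\<close> and
  \<open>1 / w\<close> exchanged. Integrability of the logarithm comes from |ln w| \<le> w + 1 /
  w.\<close>

lemma B2_exp_moments:
  assumes w: "w \<in> B2" and Q: "Q \<in> carleson_squares"
  defines "L \<equiv> mean (\<lambda>x. ln (w x)) Q"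
  shows "set_integrable area Q (\<lambda>x. ln (w x))"
    and "(LINT x:Q|area. exp (- L) * w x) \<le> (B2_const w)\<^sup>2 * measure area Q"
    and "(LINT x:Q|area. exp L * (1 / w x)) \<le> (B2_const w)\<^sup>2 * measure area Q"
proof -
  have wi: "integrable area w" and wpos: "\<And>x. x \<in> unit_disc \<Longrightarrow> 0 < w x"
    using w by (auto simp: B2_def weight_def)
  then have [measurable]: "w \<in> borel_measurable area" by auto
  have Qs[measurable]: "Q \<in> sets area" by (rule carleson_square_in_sets[OF Q])
  then have pos: "0 < w x" if "x \<in> Q" for x using that wpos by (auto simp: sets_area)
  have m: "0 < measure area Q" by (rule carleson_square_measure_pos[OF Q])
  note int = B2_means[OF w Q]
  show ln: "set_integrable area Q (\<lambda>x. ln (w x))"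
  proof (rule set_integrable_bound)
    show "set_integrable area Q (\<lambda>x. w x + 1 / w x)" using int by (intro set_integral_add)
    show "AE x in area. x \<in> Q \<longrightarrow> norm (ln (w x)) \<le> norm (w x + 1 / w x)"
    proof (intro AE_I2 impI)
      fix x assume "x \<in> Q"
      then have "0 < w x" by (rule pos)
      then have "ln (w x) \<le> w x" "ln (1 / w x) \<le> 1 / w x" "ln (1 / w x) = - ln (w x)" "0 < 1 / w x"
        using ln_less_self[of "w x"] ln_less_self[of "1 / w x"] by (simp_all add: ln_div less_imp_le)
      then show "norm (ln (w x)) \<le> norm (w x + 1 / w x)" using \<open>0 < w x\<close> unfolding real_norm_def by linarith
    qed
  qed (simp add: set_borel_measurable_def)
  have ln_inv: "ln (1 / w x) = - ln (w x)" if "x \<in> Q" for x using pos[OF that] by (simp add: ln_div)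
  have "set_integrable area Q (\<lambda>x. - ln (w x))" using ln by (simp add: set_integrable_def)
  then have ln': "set_integrable area Q (\<lambda>x. ln (1 / w x))"
    using ln_inv by (subst set_integrable_cong[OF refl refl, of Q _ "\<lambda>x. - ln (w x)"]) auto
  have "(LINT x:Q|area. ln (1 / w x)) = (LINT x:Q|area. - ln (w x))"
    using ln_inv by (intro set_lebesgue_integral_cong) auto
  then have mean': "mean (\<lambda>x. ln (1 / w x)) Q = - L" by (simp add: mean_def L_def set_lebesgue_integral_def)
  have lower: "exp L \<le> mean w Q"
    unfolding L_def by (rule exp_mean_ln_le[OF int(1) ln pos Qs m])
  have lower': "exp (- L) \<le> mean (\<lambda>x. 1 / w x) Q"
    unfolding mean'[symmetric] using pos by (intro exp_mean_ln_le[OF int(2) ln' _ Qs m]) auto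
  have "0 \<le> mean w Q" "0 \<le> mean (\<lambda>x. 1 / w x) Q"
    using lower lower' exp_gt_zero[of L] exp_gt_zero[of "- L"] by linarith+
  then have "exp (- L) * mean w Q \<le> mean w Q * mean (\<lambda>x. 1 / w x) Q"
    "exp L * mean (\<lambda>x. 1 / w x) Q \<le> mean w Q * mean (\<lambda>x. 1 / w x) Q"
    using mult_right_mono[OF lower', of "mean w Q"] mult_right_mono[OF lower, of "mean (\<lambda>x. 1 / w x) Q"]
    by (simp_all add: mult.commute)
  then have "exp (- L) * mean w Q \<le> (B2_const w)\<^sup>2" "exp L * mean (\<lambda>x. 1 / w x) Q \<le> (B2_const w)\<^sup>2"
    using int(3) by linarith+
  then have "exp (- L) * mean w Q * measure area Q \<le> (B2_const w)\<^sup>2 * measure area Q"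
    "exp L * mean (\<lambda>x. 1 / w x) Q * measure area Q \<le> (B2_const w)\<^sup>2 * measure area Q"
    using m by simp_all
  then show "(LINT x:Q|area. exp (- L) * w x) \<le> (B2_const w)\<^sup>2 * measure area Q"
    "(LINT x:Q|area. exp L * (1 / w x)) \<le> (B2_const w)\<^sup>2 * measure area Q"
    unfolding set_integral_mult_right using m by (simp_all add: mean_def)
qed

lemma markov_exp:
  assumes v: "set_integrable area Q v" "\<And>x. x \<in> Q \<Longrightarrow> 0 \<le> v x" and Q: "Q \<in> sets area"
    and A: "A \<in> sets area" "A \<subseteq> Q" "\<And>x. x \<in> A \<Longrightarrow> exp t \<le> v x"
  shows "measure area A \<le> exp (- t) * (LINT x:Q|area. v x)"
proof -
  have "exp t * measure area A = (LINT x|area. exp t * indicator A x)"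
    using A Int_absorb2[of A unit_disc] by (simp add: sets_area)
  also have "\<dots> \<le> (LINT x:Q|area. v x)"
    unfolding set_lebesgue_integral_def
  proof (rule integral_mono)
    show "integrable area (\<lambda>x. exp t * indicator A x)"
      using A by (simp add: area.emeasure_eq_measure)
    show "integrable area (\<lambda>x. indicator Q x *\<^sub>R v x)" using v(1) by (simp add: set_integrable_def)
  qed (use v(2) A in \<open>auto simp: indicator_def\<close>)
  finally show ?thesis by (simp add: exp_minus field_simps)
qed

text \<open>The upper and the lower deviation are each controlled by one exponential moment and
  Markov's inequality, hence the factor 2.\<close>

lemma B2_level_set:
  assumes w: "w \<in> B2" and Q: "Q \<in> carleson_squares"
  shows "measure area {z \<in> Q. \<bar>ln (w z) - mean (\<lambda>\<zeta>. ln (w \<zeta>)) Q\<bar> > t}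
    \<le> 2 * (B2_const w)\<^sup>2 * exp (- t) * measure area Q"
proof -
  define L where "L = mean (\<lambda>\<zeta>. ln (w \<zeta>)) Q"
  have wi: "integrable area w" and wpos: "\<And>x. x \<in> unit_disc \<Longrightarrow> 0 < w x"
    using w by (auto simp: B2_def weight_def)
  then have [measurable]: "w \<in> borel_measurable area" by auto
  have Qs[measurable]: "Q \<in> sets area" by (rule carleson_square_in_sets[OF Q])
  then have pos: "0 < w x" if "x \<in> Q" for x using that wpos by (auto simp: sets_area)
  have QD: "Q \<subseteq> unit_disc" using Qs by (simp add: sets_area)
  let ?A = "{z \<in> Q. t < ln (w z) - L}" and ?B = "{z \<in> Q. t < L - ln (w z)}"
  have "?A = {z \<in> space area. z \<in> Q \<and> t < ln (w z) - L}" using QD by auto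
  also have "\<dots> \<in> sets area" by measurable
  finally have A: "?A \<in> sets area" .
  have "?B = {z \<in> space area. z \<in> Q \<and> t < L - ln (w z)}" using QD by auto
  also have "\<dots> \<in> sets area" by measurable
  finally have B: "?B \<in> sets area" .
  note int = B2_means[OF w Q] and mom = B2_exp_moments[OF w Q]
  have "measure area ?A \<le> exp (- t) * (LINT x:Q|area. exp (- L) * w x)"
  proof (rule markov_exp)
    show "exp t \<le> exp (- L) * w x" if "x \<in> ?A" for x
    proof -
      have "exp t \<le> exp (- L + ln (w x))" using that by simp
      then show ?thesis using that pos[of x] by (simp only: exp_add) auto
    qed
    show "set_integrable area Q (\<lambda>x. exp (- L) * w x)" by (intro set_integrable_mult_right int)
  qed (use A pos in \<open>auto simp: less_imp_le\<close>)
  also have "\<dots> \<le> exp (- t) * ((B2_const w)\<^sup>2 * measure area Q)"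
    using mom(2) by (simp add: L_def)
  finally have mA: "measure area ?A \<le> exp (- t) * ((B2_const w)\<^sup>2 * measure area Q)" .
  have "measure area ?B \<le> exp (- t) * (LINT x:Q|area. exp L * (1 / w x))"
  proof (rule markov_exp)
    show "exp t \<le> exp L * (1 / w x)" if "x \<in> ?B" for x
    proof -
      have "exp t \<le> exp (L - ln (w x))" using that by simp
      then show ?thesis using that pos[of x] by (simp only: exp_diff) auto
    qed
    show "set_integrable area Q (\<lambda>x. exp L * (1 / w x))" by (intro set_integrable_mult_right int)
  qed (use B pos in \<open>auto simp: less_imp_le\<close>)
  also have "\<dots> \<le> exp (- t) * ((B2_const w)\<^sup>2 * measure area Q)"
    using mom(3) by (simp add: L_def)
  finally have mB: "measure area ?B \<le> exp (- t) * ((B2_const w)\<^sup>2 * measure area Q)" .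
  have "{z \<in> Q. \<bar>ln (w z) - L\<bar> > t} = ?A \<union> ?B" by auto
  then have "measure area {z \<in> Q. \<bar>ln (w z) - L\<bar> > t} \<le> measure area ?A + measure area ?B"
    using measure_Un_le[OF A B] by simp
  then show ?thesis using mA mB by (simp add: L_def mult_ac)
qed

lemma B2_ln_mean_osc:
  assumes w: "w \<in> B2" and Q: "Q \<in> carleson_squares" and E: "E \<in> sets area" "E \<subseteq> insert 0 Q"
  shows "(LINT x:E|area. \<bar>ln (w x) - mean (\<lambda>\<zeta>. ln (w \<zeta>)) Q\<bar>) \<le> 2 * (B2_const w)\<^sup>2 * measure area Q"
proof -
  define L where "L = mean (\<lambda>\<zeta>. ln (w \<zeta>)) Q"
  have wi: "integrable area w" and wpos: "\<And>x. x \<in> unit_disc \<Longrightarrow> 0 < w x"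
    using w by (auto simp: B2_def weight_def)
  then have [measurable]: "w \<in> borel_measurable area" by auto
  have Qs[measurable]: "Q \<in> sets area" by (rule carleson_square_in_sets[OF Q])
  have pos: "0 < w x" if "x \<in> Q" for x using that wpos Qs by (auto simp: sets_area)
  note int = B2_means[OF w Q] and mom = B2_exp_moments[OF w Q]
  have intQ: "set_integrable area Q (\<lambda>x. \<bar>ln (w x) - L\<bar>)"
  proof -
    have "set_integrable area Q (\<lambda>_. L)" using Qs by (intro set_integrable_area) auto
    then show ?thesis using mom(1) by (intro set_integrable_abs set_integral_diff)
  qed
  have "(LINT x:E|area. \<bar>ln (w x) - L\<bar>) \<le> (LINT x:Q|area. \<bar>ln (w x) - L\<bar>)"
    unfolding set_lebesgue_integral_def
  proof (rule integral_mono_AE')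
    show "integrable area (\<lambda>x. indicat_real Q x *\<^sub>R \<bar>ln (w x) - L\<bar>)"
      using intQ by (simp add: set_integrable_def)
    show "AE x in area. indicat_real E x *\<^sub>R \<bar>ln (w x) - L\<bar> \<le> indicat_real Q x *\<^sub>R \<bar>ln (w x) - L\<bar>"
      using AE_not_in[OF origin_null] by eventually_elim (use E in \<open>auto simp: indicator_def\<close>)
  qed auto
  also have "\<dots> \<le> (LINT x:Q|area. exp (- L) * w x + exp L * (1 / w x))"
  proof (intro set_integral_mono intQ set_integral_add set_integrable_mult_right int)
    fix x assume "x \<in> Q"
    then have "exp (- L) * w x = exp (ln (w x) - L)" "exp L * (1 / w x) = exp (L - ln (w x))"
      using pos[of x] by (simp_all add: exp_diff exp_minus field_simps)
    moreover have "ln (w x) - L \<le> exp (ln (w x) - L)" "L - ln (w x) \<le> exp (L - ln (w x))"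
      using exp_ge_add_one_self[of "ln (w x) - L"] exp_ge_add_one_self[of "L - ln (w x)"] by linarith+
    moreover have "0 < exp (ln (w x) - L)" "0 < exp (L - ln (w x))" by auto
    ultimately show "\<bar>ln (w x) - L\<bar> \<le> exp (- L) * w x + exp L * (1 / w x)" by linarith
  qed
  also have "\<dots> = (LINT x:Q|area. exp (- L) * w x) + (LINT x:Q|area. exp L * (1 / w x))"
    using int by (intro set_integral_add set_integrable_mult_right)
  also have "\<dots> \<le> 2 * (B2_const w)\<^sup>2 * measure area Q" using mom(2,3) by (simp add: L_def)
  finally show ?thesis by (simp add: L_def)
qed

section \<open>From Carleson squares to discs: logarithms in BMO\<close>

text \<open>The denominator of the involution is at least \<open>1 - cmod c\<close>, so its modulus
  is at most 1 / 2, and at 1 / 2 the distance equals (ln 3) / 2.\<close>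

lemma hyperbolic_dist_le:
  assumes "c \<in> unit_disc" "z \<in> unit_disc" "dist c z \<le> (1 - cmod c) / 2"
  shows "hyperbolic_dist c z \<le> 1 / 2 * ln 3"
proof -
  have "1 - cmod c \<le> cmod (1 - cnj c * z)"
  proof -
    have "cmod (cnj c * z) \<le> cmod c" using assms by (simp add: norm_mult mult_left_le)
    then show ?thesis using norm_triangle_ineq2[of 1 "cnj c * z"] by simp
  qed
  moreover have "0 < 1 - cmod c" using assms by simp
  ultimately have "cmod (disc_involution c z) \<le> ((1 - cmod c) / 2) / (1 - cmod c)"
    using assms unfolding disc_involution_def norm_divide by (intro frac_le) (auto simp: dist_norm)
  also have "\<dots> = 1 / 2" using \<open>0 < 1 - cmod c\<close> by simp
  finally have x: "cmod (disc_involution c z) \<le> 1 / 2" .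
  then have "(1 + cmod (disc_involution c z)) / (1 - cmod (disc_involution c z)) \<le> 3"
    by (simp add: pos_divide_le_eq)
  moreover have "0 < (1 + cmod (disc_involution c z)) / (1 - cmod (disc_involution c z))"
    using x norm_ge_zero[of "disc_involution c z"] by (intro divide_pos_pos) linarith+
  ultimately show ?thesis unfolding hyperbolic_dist_def by simp
qed

lemma ln_B2_in_BMO:
  assumes w: "w \<in> B2" and hyp: "bounded_hyperbolic_oscillation w"
  shows "(\<lambda>z. ln (w z)) \<in> BMO"
proof -
  have wi: "integrable area w" using w by (auto simp: B2_def weight_def)
  then have [measurable]: "w \<in> borel_measurable area" by auto
  have ln_int: "integrable area (\<lambda>z. ln (w z))"
    using B2_exp_moments(1)[OF w punctured_disc_in_carleson_squares]
    by (intro integrable_area_punctured) auto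
  obtain C where C: "0 < C" "\<And>z \<zeta>. z \<in> unit_disc \<Longrightarrow> \<zeta> \<in> unit_disc \<Longrightarrow>
    \<bar>ln (w z) - ln (w \<zeta>)\<bar> \<le> C * (1 + hyperbolic_dist z \<zeta>)"
    using hyp unfolding bounded_hyperbolic_oscillation_def by blast
  \<comment> \<open>The first entry serves discs far from the circle. In the second, 4096 is the
    largest ratio between the area of the chosen square and that of the disc.\<close>
  define K where "K = max (C * (1 + 1 / 2 * ln 3)) (2 * (B2_const w)\<^sup>2 * 4096)"
  have "mean_osc (\<lambda>z. ln (w z)) E \<le> 2 * K" if "E \<in> bmo_discs" for E
  proof -
    obtain c r where c: "c \<in> unit_disc" and r: "0 < r" and E: "E = trunc_disc c r"
      using \<open>E \<in> bmo_discs\<close> by (rule bmo_discsE)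
    have Es: "E \<in> sets area" and Em: "0 < measure area E"
      using c r by (auto simp: E measure_trunc_disc_pos)
    have square: "mean_osc (\<lambda>z. ln (w z)) E \<le> 2 * K"
      if Q: "Q \<in> carleson_squares" "E \<subseteq> insert 0 Q" "measure area Q \<le> 4096 * measure area E" for Q
    proof (rule mean_osc_le[OF ln_int Es Em])
      have "(LINT x:E|area. \<bar>ln (w x) - mean (\<lambda>\<zeta>. ln (w \<zeta>)) Q\<bar>) \<le> 2 * (B2_const w)\<^sup>2 * measure area Q"
        by (rule B2_ln_mean_osc[OF w Q(1) Es Q(2)])
      also have "\<dots> \<le> 2 * (B2_const w)\<^sup>2 * (4096 * measure area E)"
        using Q(3) by (intro mult_left_mono) auto
      also have "\<dots> = (2 * (B2_const w)\<^sup>2 * 4096) * measure area E" by simp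
      also have "\<dots> \<le> K * measure area E" using Em by (intro mult_right_mono) (auto simp: K_def)
      finally show "(LINT x:E|area. \<bar>ln (w x) - mean (\<lambda>\<zeta>. ln (w \<zeta>)) Q\<bar>) \<le> K * measure area E" .
    qed
    \<comment> \<open>In the first case the oscillation condition applies with
      \<open>ln (w c)\<close> as the constant. In the second the square has area at most (32 r)^2 =
      4096 * r^2 / 4. In the third the disc has area at least 1 / 4096, and the punctured disc
      serves as the square.\<close>
    consider "2 * r \<le> 1 - cmod c" | "1 - cmod c < 2 * r" "r \<le> 1 / 32" | "1 / 32 \<le> r" by linarith
    then show ?thesis
    proof cases
      case 1
      show ?thesis
      proof (rule mean_osc_le[OF ln_int Es Em])
        have K: "\<bar>ln (w z) - ln (w c)\<bar> \<le> K" if "z \<in> E" for z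
        proof -
          have z: "z \<in> unit_disc" "dist c z \<le> (1 - cmod c) / 2" using that 1 by (auto simp: E trunc_disc_def)
          have "\<bar>ln (w z) - ln (w c)\<bar> \<le> C * (1 + hyperbolic_dist c z)"
            using C(2)[OF c z(1)] by (simp add: abs_minus_commute)
          also have "\<dots> \<le> C * (1 + 1 / 2 * ln 3)"
            using C(1) hyperbolic_dist_le[OF c z] by (intro mult_left_mono add_left_mono) auto
          finally show ?thesis by (simp add: K_def)
        qed
        have "(LINT x:E|area. \<bar>ln (w x) - ln (w c)\<bar>) \<le> (LINT x:E|area. K)"
          using ln_int Es K by (intro set_integral_mono set_integrable_area) auto
        also have "\<dots> = K * measure area E"
          using Es Int_absorb2[of E unit_disc] by (simp add: sets_area set_lebesgue_integral_def)
        finally show "(LINT x:E|area. \<bar>ln (w x) - ln (w c)\<bar>) \<le> K * measure area E" .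
      qed
    next
      case 2
      obtain Q where Q: "Q \<in> carleson_squares" "E \<subseteq> Q" "measure area Q \<le> (32 * r)\<^sup>2"
        using boundary_disc_in_carleson_square[OF c 2] by (auto simp: E)
      note Q(3)
      also have "(32 * r)\<^sup>2 = 4096 * (r\<^sup>2 / 4)" by (simp add: power_mult_distrib)
      also have "\<dots> \<le> 4096 * measure area E"
        using area_disc_bounds(2)[OF c r] 2 by (simp add: E trunc_disc_def)
      finally show ?thesis using Q by (intro square[of Q]) auto
    next
      case 3
      have "(1 / 32)\<^sup>2 / 4 \<le> measure area (trunc_disc c (1 / 32))"
        using area_disc_bounds(2)[of c "1 / 32"] c by (simp add: trunc_disc_def)
      also have "\<dots> \<le> measure area E"
        using 3 by (intro area.finite_measure_mono Es) (auto simp: E trunc_disc_def)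
      finally have "1 \<le> 4096 * measure area E" by (simp add: power_divide)
      moreover have "measure area (unit_disc - {0}) \<le> 1"
        using area.finite_measure_mono[of "unit_disc - {0}" unit_disc] emeasure_area_space
        by (simp add: sets_area measure_def)
      ultimately show ?thesis
        using Es by (intro square[OF punctured_disc_in_carleson_squares]) (auto simp: sets_area)
    qed
  qed
  then have "bdd_above (mean_osc (\<lambda>z. ln (w z)) ` bmo_discs)" by (intro bdd_aboveI2)
  then show ?thesis using ln_int by (simp add: BMO_def)
qed

theorem lemma2p4:
  shows "(\<exists>C\<^sub>1 C\<^sub>2 :: real. 0 < C\<^sub>1 \<and> 0 < C\<^sub>2 \<and>
            (\<forall>f\<in>BMO. bmo_norm f \<noteq> 0 \<longrightarrow>
               (\<lambda>z. exp (C\<^sub>2 * f z / bmo_norm f)) \<in> B2 \<and>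
               B2_const (\<lambda>z. exp (C\<^sub>2 * f z / bmo_norm f)) \<le> C\<^sub>1)) \<and>
         (\<forall>f\<in>VMO.
            ((\<lambda>\<delta>::real. SUP Q\<in>{Q \<in> carleson_squares. measure area Q < \<delta>}.
                 nn_mean (\<lambda>z. exp (f z)) Q * nn_mean (\<lambda>z. exp (- f z)) Q)
               \<longlongrightarrow> 1) (at_right 0)) \<and>
         (\<forall>w\<in>B2. \<forall>t > 2 + ln (B2_const w). \<forall>Q\<in>carleson_squares.
            measure area {z \<in> Q. \<bar>ln (w z) - mean (\<lambda>\<zeta>. ln (w \<zeta>)) Q\<bar> > t}
              \<le> 2 * exp 2 * (B2_const w)\<^sup>2 * exp (- t) * measure area Q) \<and>
         (\<forall>w\<in>B2. bounded_hyperbolic_oscillation w \<longrightarrow> (\<lambda>z. ln (w z)) \<in> BMO)"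
proof (intro conjI ballI impI allI)
  show "\<exists>C\<^sub>1 C\<^sub>2 :: real. 0 < C\<^sub>1 \<and> 0 < C\<^sub>2 \<and>
            (\<forall>f\<in>BMO. bmo_norm f \<noteq> 0 \<longrightarrow>
               (\<lambda>z. exp (C\<^sub>2 * f z / bmo_norm f)) \<in> B2 \<and>
               B2_const (\<lambda>z. exp (C\<^sub>2 * f z / bmo_norm f)) \<le> C\<^sub>1)"
    using exp_BMO_in_B2 by (intro exI[of _ 1280] exI[of _ "ln 2 / 6400"]) auto
next
  fix w t Q assume w: "w \<in> B2" and Q: "Q \<in> carleson_squares"
  have "measure area {z \<in> Q. \<bar>ln (w z) - mean (\<lambda>\<zeta>. ln (w \<zeta>)) Q\<bar> > t}
    \<le> 1 * (2 * (B2_const w)\<^sup>2 * exp (- t) * measure area Q)"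
    using B2_level_set[OF w Q] by simp
  also have "\<dots> \<le> exp 2 * (2 * (B2_const w)\<^sup>2 * exp (- t) * measure area Q)"
    by (intro mult_right_mono) auto
  finally show "measure area {z \<in> Q. \<bar>ln (w z) - mean (\<lambda>\<zeta>. ln (w \<zeta>)) Q\<bar> > t}
    \<le> 2 * exp 2 * (B2_const w)\<^sup>2 * exp (- t) * measure area Q" by (simp add: mult_ac)
qed (auto intro: VMO_exp_prod_tendsto ln_B2_in_BMO)

end
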